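(* Let $n\ge 1$ and let $(M^{2n+1},\phi,\xi,\eta,g)$ be an almost Kenmotsu manifold with Reeb (characteristic) vector field $\xi$. Then $M$ does not admit a Ricci soliton with potential vector field $\xi$; that is, there is no constant $\lambda\in\mathbb{R}$ such that $$\mathcal{L}_{\xi}g+2S-2\lambda g=0 \quad\text{on } M,$$ where $\mathcal{L}_\xi g$ is the Lie derivative of $g$ along $\xi$ and $S$ is the Ricci tensor of type $(0,2)$ of $g$.
   Context: All manifolds are smooth and nonempty, and all tensor fields are smooth. An almost contact structure on a manifold $M^{2n+1}$ of dimension $2n+1$ is a triple $(\phi,\xi,\eta)$ consisting of a $(1,1)$-tensor field $\phi$, a vector field $\xi$ (the characteristic or Reeb vector field) and a $1$-form $\eta$ such that $\phi^2=-I+\eta\otimes\xi$ and $\eta(\xi)=1$, where $I$ is the identity endomorphism (it follows that $\phi\xi=0$ and $\eta\circ\phi=0$). If moreover $g$ is a Riemannian metric on $M$ with $g(\phi E,\phi F)=g(E,F)-\eta(E)\eta(F)$ for all vector fields $E,F$, then $(M,\phi,\xi,\eta,g)$ is called an almost contact metric manifold. Its fundamental $2$-form is $\Phi(E,F)=g(E,\phi F)$. An almost Kenmotsu manifold is an almost contact metric manifold such that $d\eta=0$ and $d\Phi=2\eta\wedge\Phi$. A Ricci soliton on a Riemannian manifold $(M,g)$ is a triple $(g,V,\lambda)$, with $V$ a smooth vector field (the potential vector field) and $\lambda$ a real constant, such that $\mathcal{L}_V g+2S-2\lambda g=0$, where $S$ is the Ricci tensor of $g$. *)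

theory Defs
  imports "HOL-Analysis.Analysis"
begin

section \<open>Smooth maps between open subsets of Euclidean spaces\<close>

abbreviation dir_deriv :: "('e::real_normed_vector \<Rightarrow> 'f::real_normed_vector) \<Rightarrow> 'e \<Rightarrow> 'e \<Rightarrow> 'f"
  where "dir_deriv f x \<equiv> frechet_derivative f (at x)"

(* Meant for open S in a finite-dimensional space. *)
primrec Ck_on :: "nat \<Rightarrow> 'e::real_normed_vector set \<Rightarrow> ('e \<Rightarrow> 'f::real_normed_vector) \<Rightarrow> bool"
  where
    "Ck_on 0 S f \<longleftrightarrow> continuous_on S f"
  | "Ck_on (Suc k) S f \<longleftrightarrow>
       (\<forall>x\<in>S. f differentiable (at x)) \<and> (\<forall>v. Ck_on k S (\<lambda>x. dir_deriv f x v))"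

definition smooth_on :: "'e::real_normed_vector set \<Rightarrow> ('e \<Rightarrow> 'f::real_normed_vector) \<Rightarrow> bool"
  where "smooth_on S f \<longleftrightarrow> (\<forall>k. Ck_on k S f)"


section \<open>Smooth manifolds\<close>

(* A chart is a domain together with a coordinate map; the values of the map outside the
   domain are irrelevant. *)
type_synonym ('a, 'e) chart = "'a set \<times> ('a \<Rightarrow> 'e)"

definition chart_image :: "('a, 'e) chart \<Rightarrow> 'e set"
  where "chart_image c = snd c ` fst c"

definition is_chart :: "'a topology \<Rightarrow> ('a, 'e::euclidean_space) chart \<Rightarrow> bool"
  where "is_chart X c \<longleftrightarrow>
    openin X (fst c) \<and> open (chart_image c) \<and>
    homeomorphic_map (subtopology X (fst c)) (top_of_set (chart_image c)) (snd c)"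

definition overlap :: "('a, 'e) chart \<Rightarrow> ('a, 'e) chart \<Rightarrow> 'e set"
  where "overlap c d = snd c ` (fst c \<inter> fst d)"

definition transition :: "('a, 'e) chart \<Rightarrow> ('a, 'e) chart \<Rightarrow> 'e \<Rightarrow> 'e"
  where "transition c d x = snd d (inv_into (fst c) (snd c) x)"

definition smooth_atlas :: "'a topology \<Rightarrow> ('a, 'e::euclidean_space) chart set \<Rightarrow> bool"
  where "smooth_atlas X A \<longleftrightarrow>
    (\<forall>c\<in>A. is_chart X c) \<and> (\<Union>c\<in>A. fst c) = topspace X \<and>
    (\<forall>c\<in>A. \<forall>d\<in>A. smooth_on (overlap c d) (transition c d))"

(* The atlas need not be maximal: it determines the smooth structure. The dimension is DIM('e). *)
definition smooth_manifold :: "'a topology \<Rightarrow> ('a, 'e::euclidean_space) chart set \<Rightarrow> bool"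
  where "smooth_manifold X A \<longleftrightarrow>
    topspace X \<noteq> {} \<and> Hausdorff_space X \<and> second_countable X \<and> smooth_atlas X A"


section \<open>Smooth tensor fields\<close>

(* A tensor field is given by its local representatives T c x, one for each chart c of the atlas,
   where x ranges over chart_image c and the tangent space at the point with coordinates x is
   identified with 'e through c. The representatives in different charts are related by the
   differential of the change of coordinates. Thus these are sections of the tensor bundles
   obtained by gluing the local trivializations over the charts. Values at x outside
   chart_image c are irrelevant. *)

type_synonym ('a, 'e) vfield = "('a, 'e) chart \<Rightarrow> 'e \<Rightarrow> 'e"
type_synonym ('a, 'e) endo = "('a, 'e) chart \<Rightarrow> 'e \<Rightarrow> 'e \<Rightarrow> 'e"
type_synonym ('a, 'e) form1 = "('a, 'e) chart \<Rightarrow> 'e \<Rightarrow> 'e \<Rightarrow> real"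
type_synonym ('a, 'e) tensor2 = "('a, 'e) chart \<Rightarrow> 'e \<Rightarrow> 'e \<Rightarrow> 'e \<Rightarrow> real"
type_synonym ('a, 'e) tensor3 = "('a, 'e) chart \<Rightarrow> 'e \<Rightarrow> 'e \<Rightarrow> 'e \<Rightarrow> 'e \<Rightarrow> real"

definition vector_field :: "('a, 'e::euclidean_space) chart set \<Rightarrow> ('a, 'e) vfield \<Rightarrow> bool"
  where "vector_field A V \<longleftrightarrow>
    (\<forall>c\<in>A. smooth_on (chart_image c) (V c)) \<and>
    (\<forall>c\<in>A. \<forall>d\<in>A. \<forall>x\<in>overlap c d.
       V d (transition c d x) = dir_deriv (transition c d) x (V c x))"

definition endo_field :: "('a, 'e::euclidean_space) chart set \<Rightarrow> ('a, 'e) endo \<Rightarrow> bool"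
  where "endo_field A T \<longleftrightarrow>
    (\<forall>c\<in>A. \<forall>x\<in>chart_image c. linear (T c x)) \<and>
    (\<forall>c\<in>A. \<forall>u. smooth_on (chart_image c) (\<lambda>x. T c x u)) \<and>
    (\<forall>c\<in>A. \<forall>d\<in>A. \<forall>x\<in>overlap c d. \<forall>u.
       T d (transition c d x) (dir_deriv (transition c d) x u) =
         dir_deriv (transition c d) x (T c x u))"

definition one_form :: "('a, 'e::euclidean_space) chart set \<Rightarrow> ('a, 'e) form1 \<Rightarrow> bool"
  where "one_form A w \<longleftrightarrow>
    (\<forall>c\<in>A. \<forall>x\<in>chart_image c. linear (w c x)) \<and>
    (\<forall>c\<in>A. \<forall>u. smooth_on (chart_image c) (\<lambda>x. w c x u)) \<and>
    (\<forall>c\<in>A. \<forall>d\<in>A. \<forall>x\<in>overlap c d. \<forall>u.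
       w d (transition c d x) (dir_deriv (transition c d) x u) = w c x u)"

definition tensor2_field :: "('a, 'e::euclidean_space) chart set \<Rightarrow> ('a, 'e) tensor2 \<Rightarrow> bool"
  where "tensor2_field A T \<longleftrightarrow>
    (\<forall>c\<in>A. \<forall>x\<in>chart_image c. bilinear (T c x)) \<and>
    (\<forall>c\<in>A. \<forall>u v. smooth_on (chart_image c) (\<lambda>x. T c x u v)) \<and>
    (\<forall>c\<in>A. \<forall>d\<in>A. \<forall>x\<in>overlap c d. \<forall>u v.
       T d (transition c d x) (dir_deriv (transition c d) x u) (dir_deriv (transition c d) x v) =
         T c x u v)"

definition riemannian_metric :: "('a, 'e::euclidean_space) chart set \<Rightarrow> ('a, 'e) tensor2 \<Rightarrow> bool"
  where "riemannian_metric A g \<longleftrightarrow> tensor2_field A g \<and>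
    (\<forall>c\<in>A. \<forall>x\<in>chart_image c.
       (\<forall>u v. g c x u v = g c x v u) \<and> (\<forall>u. u \<noteq> 0 \<longrightarrow> g c x u u > 0))"


section \<open>Exterior calculus and Lie derivative\<close>

(* In the operators below, constant maps on 'e serve as coordinate vector fields, which commute. *)

definition ext_deriv1 :: "('a, 'e::euclidean_space) form1 \<Rightarrow> ('a, 'e) tensor2"
  where "ext_deriv1 w c x u v =
    dir_deriv (\<lambda>y. w c y v) x u - dir_deriv (\<lambda>y. w c y u) x v"

definition ext_deriv2 :: "('a, 'e::euclidean_space) tensor2 \<Rightarrow> ('a, 'e) tensor3"
  where "ext_deriv2 w c x u v z =
    dir_deriv (\<lambda>y. w c y v z) x u - dir_deriv (\<lambda>y. w c y u z) x v
      + dir_deriv (\<lambda>y. w c y u v) x z"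

(* Normalized compatibly with the exterior derivative, i.e. without factors 1/p! in either. *)
definition wedge12 :: "('a, 'e) form1 \<Rightarrow> ('a, 'e) tensor2 \<Rightarrow> ('a, 'e) tensor3"
  where "wedge12 a w c x u v z =
    a c x u * w c x v z - a c x v * w c x u z + a c x z * w c x u v"

definition lie_bracket :: "('e::real_normed_vector \<Rightarrow> 'e) \<Rightarrow> ('e \<Rightarrow> 'e) \<Rightarrow> 'e \<Rightarrow> 'e"
  where "lie_bracket P Q x = dir_deriv Q x (P x) - dir_deriv P x (Q x)"

definition lie_deriv2 ::
    "('a, 'e::euclidean_space) vfield \<Rightarrow> ('a, 'e) tensor2 \<Rightarrow> ('a, 'e) tensor2"
  where "lie_deriv2 V T c x u v =
    dir_deriv (\<lambda>y. T c y u v) x (V c x)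
      - T c x (lie_bracket (V c) (\<lambda>_. u) x) v - T c x u (lie_bracket (V c) (\<lambda>_. v) x)"


section \<open>Levi-Civita connection and Ricci tensor\<close>

(* The Koszul formula for coordinate vector fields; it determines the vector uniquely because
   g is nondegenerate (and at a point outside chart_image c the value is irrelevant). *)
definition christoffel ::
    "('a, 'e::euclidean_space) tensor2 \<Rightarrow> ('a, 'e) chart \<Rightarrow> 'e \<Rightarrow> 'e \<Rightarrow> 'e \<Rightarrow> 'e"
  where "christoffel g c x u v = (THE w. \<forall>z. 2 * g c x w z =
    dir_deriv (\<lambda>y. g c y v z) x u + dir_deriv (\<lambda>y. g c y u z) x v
      - dir_deriv (\<lambda>y. g c y u v) x z)"

(* The Levi-Civita derivative of Q along P, for vector fields P, Q expressed in the chart c. *)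
definition cov_deriv ::
    "('a, 'e::euclidean_space) tensor2 \<Rightarrow> ('a, 'e) chart \<Rightarrow> ('e \<Rightarrow> 'e) \<Rightarrow> ('e \<Rightarrow> 'e) \<Rightarrow> 'e \<Rightarrow> 'e"
  where "cov_deriv g c P Q x = dir_deriv Q x (P x) + christoffel g c x (P x) (Q x)"

definition curvature ::
    "('a, 'e::euclidean_space) tensor2 \<Rightarrow> ('a, 'e) chart \<Rightarrow>
      ('e \<Rightarrow> 'e) \<Rightarrow> ('e \<Rightarrow> 'e) \<Rightarrow> ('e \<Rightarrow> 'e) \<Rightarrow> 'e \<Rightarrow> 'e"
  where "curvature g c P Q Z x =
    cov_deriv g c P (cov_deriv g c Q Z) x - cov_deriv g c Q (cov_deriv g c P Z) x
      - cov_deriv g c (lie_bracket P Q) Z x"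

definition endo_trace :: "('e::euclidean_space \<Rightarrow> 'e) \<Rightarrow> real"
  where "endo_trace L = (\<Sum>b\<in>Basis. L b \<bullet> b)"

(* S(u,v) = trace (w |-> R(w,u)v), so the Ricci tensor of a round sphere is positive. *)
definition ricci :: "('a, 'e::euclidean_space) tensor2 \<Rightarrow> ('a, 'e) tensor2"
  where "ricci g c x u v = endo_trace (\<lambda>w. curvature g c (\<lambda>_. w) (\<lambda>_. u) (\<lambda>_. v) x)"

definition ricci_soliton ::
    "'a topology \<Rightarrow> ('a, 'e::euclidean_space) chart set \<Rightarrow>
      ('a, 'e) tensor2 \<Rightarrow> ('a, 'e) vfield \<Rightarrow> real \<Rightarrow> bool"
  where "ricci_soliton X A g V l \<longleftrightarrow>
    smooth_manifold X A \<and> riemannian_metric A g \<and> vector_field A V \<and>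
    (\<forall>c\<in>A. \<forall>x\<in>chart_image c. \<forall>u v.
       lie_deriv2 V g c x u v + 2 * ricci g c x u v - 2 * l * g c x u v = 0)"


section \<open>Almost Kenmotsu manifolds\<close>

definition almost_contact ::
    "('a, 'e::euclidean_space) chart set \<Rightarrow>
      ('a, 'e) endo \<Rightarrow> ('a, 'e) vfield \<Rightarrow> ('a, 'e) form1 \<Rightarrow> bool"
  where "almost_contact A \<phi> \<xi> \<eta> \<longleftrightarrow>
    endo_field A \<phi> \<and> vector_field A \<xi> \<and> one_form A \<eta> \<and>
    (\<forall>c\<in>A. \<forall>x\<in>chart_image c.
       (\<forall>u. \<phi> c x (\<phi> c x u) = - u + \<eta> c x u *\<^sub>R \<xi> c x) \<and> \<eta> c x (\<xi> c x) = 1)"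

definition almost_contact_metric ::
    "('a, 'e::euclidean_space) chart set \<Rightarrow>
      ('a, 'e) endo \<Rightarrow> ('a, 'e) vfield \<Rightarrow> ('a, 'e) form1 \<Rightarrow> ('a, 'e) tensor2 \<Rightarrow> bool"
  where "almost_contact_metric A \<phi> \<xi> \<eta> g \<longleftrightarrow>
    almost_contact A \<phi> \<xi> \<eta> \<and> riemannian_metric A g \<and>
    (\<forall>c\<in>A. \<forall>x\<in>chart_image c. \<forall>u v.
       g c x (\<phi> c x u) (\<phi> c x v) = g c x u v - \<eta> c x u * \<eta> c x v)"

definition fundamental_form ::
    "('a, 'e) endo \<Rightarrow> ('a, 'e) tensor2 \<Rightarrow> ('a, 'e) tensor2"
  where "fundamental_form \<phi> g c x u v = g c x u (\<phi> c x v)"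

(* The dimension of the manifold, DIM('e), is odd by a separate assumption. *)
definition almost_kenmotsu ::
    "'a topology \<Rightarrow> ('a, 'e::euclidean_space) chart set \<Rightarrow>
      ('a, 'e) endo \<Rightarrow> ('a, 'e) vfield \<Rightarrow> ('a, 'e) form1 \<Rightarrow> ('a, 'e) tensor2 \<Rightarrow> bool"
  where "almost_kenmotsu X A \<phi> \<xi> \<eta> g \<longleftrightarrow>
    smooth_manifold X A \<and> almost_contact_metric A \<phi> \<xi> \<eta> g \<and>
    (\<forall>c\<in>A. \<forall>x\<in>chart_image c.
       (\<forall>u v. ext_deriv1 \<eta> c x u v = 0) \<and>
       (\<forall>u v z. ext_deriv2 (fundamental_form \<phi> g) c x u v z =
          2 * wedge12 \<eta> (fundamental_form \<phi> g) c x u v z))"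

end

theory Submission
  imports Defs
begin

text \<open>
Write \<open>D\<close> for the Levi-Civita connection, \<open>S\<close> for the Ricci tensor, and consider the endomorphism
\<open>B u = D\<^sub>u \<xi>\<close>, called \<open>shape\<close> below. Four facts about \<open>B\<close> decide the matter.

\<^item> Closedness of \<open>\<eta> = g(\<cdot>, \<xi>)\<close> says that \<open>B\<close> is self-adjoint, and \<open>g(\<xi>, \<xi>) = 1\<close> then gives \<open>B \<xi> = 0\<close>.
  Hence the Lie derivative of \<open>g\<close> along \<open>\<xi>\<close> is \<open>2 g(B \<cdot>, \<cdot>)\<close>, and the soliton equation becomes
  \<open>S = \<lambda> g - g(B \<cdot>, \<cdot>)\<close> (\<open>shape_self_adjoint\<close>, \<open>lie_derivative_metric\<close>).

\<^item> The equation \<open>d\<Phi> = 2 \<eta> \<and> \<Phi>\<close>, contracted with \<open>\<xi>\<close>, expresses the Lie derivative of \<open>\<phi>\<close> along \<open>\<xi>\<close>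
  through \<open>B\<close>. Composing with \<open>\<phi>\<close> and taking the trace gives \<open>tr B = dim M - 1\<close>, a nonzero constant
  (\<open>lie_derivative_phi\<close>, \<open>trace_shape\<close>).

\<^item> Since \<open>R(u, v) \<xi> = (D\<^sub>u B) v - (D\<^sub>v B) u\<close> and \<open>tr B\<close> is constant, \<open>S(v, \<xi>)\<close> is the divergence of \<open>B\<close>,
  evaluated at \<open>v\<close>. Inserting \<open>v = \<xi>\<close> and using \<open>B \<xi> = 0\<close>, one gets \<open>S(\<xi>, \<xi>) = - tr (B\<^sup>2)\<close>,
  which is negative because \<open>B\<close> is self-adjoint and nonzero (\<open>ricci_xi\<close>, \<open>ricci_xi_xi\<close>).

\<^item> The contracted second Bianchi identity \<open>2 div S = d (tr S)\<close>, applied to \<open>S = \<lambda> g - g(B \<cdot>, \<cdot>)\<close>, reads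
  \<open>2 div B = d (tr B) = 0\<close>. By the previous item \<open>S(\<cdot>, \<xi>) = div B = 0\<close> (\<open>soliton_ricci_xi\<close>).

The last two items contradict each other at every point, so the argument is local and takes place in
a single chart, with constant maps as coordinate vector fields. Everything rests on the second
Bianchi identity, which is the Jacobi identity for the operators \<open>D\<^sub>u\<close> with \<open>u\<close> constant; it is read off
at a point after applying third-order operators to a constant field. This requires smooth
Christoffel symbols, obtained from the smooth dependence of solutions of \<open>g\<^sub>x(w, \<cdot>) = k\<^sub>x\<close> on \<open>x\<close>,
and the symmetry of second derivatives.
\<close>

section \<open>Calculus of smooth maps\<close>

lemma dir_deriv_eq: "(f has_derivative f') (at x) \<Longrightarrow> dir_deriv f x v = f' v"
  by (metis frechet_derivative_at)

lemma has_derivative_dir_deriv: "f differentiable (at x) \<Longrightarrow> (f has_derivative dir_deriv f x) (at x)"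
  by (simp add: frechet_derivative_works)

lemma dir_deriv_cong:
  assumes "open S" "x \<in> S" "\<And>y. y \<in> S \<Longrightarrow> f y = g y" "f differentiable (at x)"
  shows "dir_deriv f x = dir_deriv g x"
  by (metis assms frechet_derivative_transform_within_open)

lemma differentiable_cong_open:
  assumes "open S" "x \<in> S" "\<And>y. y \<in> S \<Longrightarrow> f y = g y"
  shows "f differentiable (at x) \<longleftrightarrow> g differentiable (at x)"
  unfolding differentiable_def
  by (metis assms has_derivative_transform_within_open)

lemma Ck_on_cong_aux:
  assumes "open S"
  shows "(\<And>y. y \<in> S \<Longrightarrow> f y = g y) \<Longrightarrow> Ck_on k S f \<Longrightarrow> Ck_on k S g"
proof (induction k arbitrary: f g)
  case 0 then show ?case by (simp cong: continuous_on_cong)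
next
  case (Suc k)
  have d: "f differentiable (at x)" if "x \<in> S" for x using Suc.prems that by simp
  have "g differentiable (at x)" if "x \<in> S" for x
    using d[OF that] differentiable_cong_open[OF assms that, of f g] Suc.prems(1) by blast
  moreover have "Ck_on k S (\<lambda>x. dir_deriv g x v)" for v
  proof (rule Suc.IH)
    show "dir_deriv f y v = dir_deriv g y v" if "y \<in> S" for y
      using dir_deriv_cong[OF assms that, of f g] Suc.prems(1) d[OF that] by metis
    show "Ck_on k S (\<lambda>x. dir_deriv f x v)" using Suc.prems by simp
  qed
  ultimately show ?case by simp
qed

lemma Ck_on_cong:
  "open S \<Longrightarrow> (\<And>y. y \<in> S \<Longrightarrow> f y = g y) \<Longrightarrow> Ck_on k S f \<longleftrightarrow> Ck_on k S g"
  by (metis Ck_on_cong_aux)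

lemma Ck_on_Suc_imp: "Ck_on (Suc k) S f \<Longrightarrow> Ck_on k S f"
proof (induction k arbitrary: f)
  case 0 then show ?case
    by (auto intro!: continuous_at_imp_continuous_on differentiable_imp_continuous_within)
next
  case (Suc k) then show ?case by (simp del: Ck_on.simps(2) add: Ck_on.simps(2)[of "Suc k"] Ck_on.simps(2)[of k S f])
qed

lemma Ck_on_const: "Ck_on k S (\<lambda>x. a)"
  by (induction k arbitrary: a) (auto)

lemma Ck_on_add:
  assumes "open S"
  shows "Ck_on k S f \<Longrightarrow> Ck_on k S g \<Longrightarrow> Ck_on k S (\<lambda>x. f x + g x)"
proof (induction k arbitrary: f g)
  case 0 then show ?case by (auto intro: continuous_intros)
next
  case (Suc k)
  have *: "dir_deriv (\<lambda>x. f x + g x) x v = dir_deriv f x v + dir_deriv g x v" if "x \<in> S" for x v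
    using that Suc.prems by (intro dir_deriv_eq has_derivative_add has_derivative_dir_deriv) auto
  have "Ck_on k S (\<lambda>x. dir_deriv (\<lambda>x. f x + g x) x v)" for v
    using Suc by (subst Ck_on_cong[OF assms *]) auto
  then show ?case using Suc.prems by auto
qed

lemma Ck_on_scaleR:
  fixes r :: "'e::real_normed_vector \<Rightarrow> real"
  assumes "open S"
  shows "Ck_on k S r \<Longrightarrow> Ck_on k S f \<Longrightarrow> Ck_on k S (\<lambda>x. r x *\<^sub>R f x)"
proof (induction k arbitrary: r f)
  case 0 then show ?case by (auto intro: continuous_intros)
next
  case (Suc k)
  have *: "dir_deriv (\<lambda>x. r x *\<^sub>R f x) x v = r x *\<^sub>R dir_deriv f x v + dir_deriv r x v *\<^sub>R f x"
    if "x \<in> S" for x v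
    using that Suc.prems by (intro dir_deriv_eq has_derivative_scaleR has_derivative_dir_deriv) auto
  have "Ck_on k S (\<lambda>x. dir_deriv (\<lambda>x. r x *\<^sub>R f x) x v)" for v
    using Suc.prems Ck_on_Suc_imp[OF Suc.prems(1)] Ck_on_Suc_imp[OF Suc.prems(2)]
    by (subst Ck_on_cong[OF assms *]) (auto intro!: Ck_on_add[OF assms] Suc.IH)
  then show ?case using Suc.prems by auto
qed

lemma Ck_on_linear:
  assumes "open S" "bounded_linear L"
  shows "Ck_on k S f \<Longrightarrow> Ck_on k S (\<lambda>x. L (f x))"
proof (induction k arbitrary: f)
  case 0 then show ?case
    using bounded_linear.continuous_on[OF assms(2)] by auto
next
  case (Suc k)
  have *: "dir_deriv (\<lambda>x. L (f x)) x v = L (dir_deriv f x v)" if "x \<in> S" for x v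
    using that Suc.prems
    by (intro dir_deriv_eq bounded_linear.has_derivative[OF assms(2)] has_derivative_dir_deriv) auto
  have "(\<lambda>x. L (f x)) differentiable (at x)" if "x \<in> S" for x
    using that Suc.prems bounded_linear.has_derivative[OF assms(2) has_derivative_dir_deriv]
    by (intro differentiableI) auto
  moreover have "Ck_on k S (\<lambda>x. dir_deriv (\<lambda>x. L (f x)) x v)" for v
    using Suc by (subst Ck_on_cong[OF assms(1) *]) auto
  ultimately show ?case by auto
qed

lemma Ck_on_diff:
  assumes "open S" "Ck_on k S f" "Ck_on k S g"
  shows "Ck_on k S (\<lambda>x. f x - g x)"
  using Ck_on_add[OF assms(1,2) Ck_on_linear[OF assms(1) _ assms(3), of uminus]]
  by (simp add: bounded_linear_minus bounded_linear_ident)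

lemma smooth_on_differentiable: "smooth_on S f \<Longrightarrow> x \<in> S \<Longrightarrow> f differentiable (at x)"
  unfolding smooth_on_def by (metis Ck_on.simps(2))

lemma smooth_on_has_derivative:
  "smooth_on S f \<Longrightarrow> x \<in> S \<Longrightarrow> (f has_derivative dir_deriv f x) (at x)"
  by (simp add: has_derivative_dir_deriv smooth_on_differentiable)

lemma smooth_on_deriv: "smooth_on S f \<Longrightarrow> smooth_on S (\<lambda>x. dir_deriv f x v)"
  unfolding smooth_on_def by (metis Ck_on.simps(2))

lemma smooth_on_continuous: "smooth_on S f \<Longrightarrow> continuous_on S f"
  unfolding smooth_on_def by (metis Ck_on.simps(1))

lemma smooth_on_const: "smooth_on S (\<lambda>x. a)"
  by (simp add: smooth_on_def Ck_on_const)

lemma smooth_on_add: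
  "open S \<Longrightarrow> smooth_on S f \<Longrightarrow> smooth_on S g \<Longrightarrow> smooth_on S (\<lambda>x. f x + g x)"
  by (simp add: smooth_on_def Ck_on_add)

lemma smooth_on_scaleR:
  "open S \<Longrightarrow> smooth_on S r \<Longrightarrow> smooth_on S f \<Longrightarrow> smooth_on S (\<lambda>x. r x *\<^sub>R f x)"
  by (simp add: smooth_on_def Ck_on_scaleR)

lemma smooth_on_linear:
  "open S \<Longrightarrow> bounded_linear L \<Longrightarrow> smooth_on S f \<Longrightarrow> smooth_on S (\<lambda>x. L (f x))"
  by (simp add: smooth_on_def Ck_on_linear)

lemma smooth_on_diff:
  "open S \<Longrightarrow> smooth_on S f \<Longrightarrow> smooth_on S g \<Longrightarrow> smooth_on S (\<lambda>x. f x - g x)"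
  by (simp add: smooth_on_def Ck_on_diff)

lemma smooth_on_inner:
  "open S \<Longrightarrow> smooth_on S f \<Longrightarrow> smooth_on S (\<lambda>x. f x \<bullet> b)"
  by (rule smooth_on_linear[OF _ bounded_linear_inner_left])

lemma smooth_on_sum:
  assumes "open S" shows "(\<And>i. i \<in> I \<Longrightarrow> smooth_on S (f i)) \<Longrightarrow> smooth_on S (\<lambda>x. \<Sum>i\<in>I. f i x)"
  by (induction I rule: infinite_finite_induct) (auto simp: smooth_on_const intro!: smooth_on_add assms)

lemma dir_deriv_linear: "smooth_on S f \<Longrightarrow> x \<in> S \<Longrightarrow> linear (dir_deriv f x)"
  by (simp add: linear_frechet_derivative smooth_on_differentiable)

lemma dir_deriv_add:
  "smooth_on S f \<Longrightarrow> smooth_on S g \<Longrightarrow> x \<in> S \<Longrightarrow>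
    dir_deriv (\<lambda>y. f y + g y) x v = dir_deriv f x v + dir_deriv g x v"
  by (intro dir_deriv_eq has_derivative_add smooth_on_has_derivative)

lemma dir_deriv_diff:
  "smooth_on S f \<Longrightarrow> smooth_on S g \<Longrightarrow> x \<in> S \<Longrightarrow>
    dir_deriv (\<lambda>y. f y - g y) x v = dir_deriv f x v - dir_deriv g x v"
  by (intro dir_deriv_eq has_derivative_diff smooth_on_has_derivative)

lemma dir_deriv_inner:
  "smooth_on S f \<Longrightarrow> x \<in> S \<Longrightarrow> dir_deriv (\<lambda>y. f y \<bullet> b) x v = dir_deriv f x v \<bullet> b"
  by (intro dir_deriv_eq has_derivative_inner_left smooth_on_has_derivative)

lemma dir_deriv_scaleR:
  "smooth_on S r \<Longrightarrow> smooth_on S f \<Longrightarrow> x \<in> S \<Longrightarrow>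
    dir_deriv (\<lambda>y. r y *\<^sub>R f y) x v = r x *\<^sub>R dir_deriv f x v + dir_deriv r x v *\<^sub>R f x"
  by (intro dir_deriv_eq has_derivative_scaleR smooth_on_has_derivative)

lemma linear_basis_expansion:
  fixes L :: "'e::euclidean_space \<Rightarrow> 'f::real_vector"
  assumes "linear L" shows "L u = (\<Sum>b\<in>Basis. (u \<bullet> b) *\<^sub>R L b)"
proof -
  have "L u = L (\<Sum>b\<in>Basis. (u \<bullet> b) *\<^sub>R b)" by (simp add: euclidean_representation)
  then show ?thesis by (simp add: linear_sum[OF assms] linear_scale[OF assms])
qed

lemma Ck_on_sum:
  assumes "open S" shows "(\<And>i. i \<in> I \<Longrightarrow> Ck_on k S (f i)) \<Longrightarrow> Ck_on k S (\<lambda>x. \<Sum>i\<in>I. f i x)"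
  by (induction I rule: infinite_finite_induct) (auto simp: Ck_on_const intro!: Ck_on_add assms)

text \<open>
Fields of linear maps are given by their values on constant arguments only. Expanding the argument in
the standard basis transfers regularity, and the Leibniz rule below, to variable arguments \<open>P y\<close>.
\<close>

lemma Ck_on_apply:
  fixes L :: "'e::euclidean_space \<Rightarrow> 'e \<Rightarrow> 'f::real_normed_vector"
  assumes op: "open S" and lin: "\<And>y. y \<in> S \<Longrightarrow> linear (L y)"
    and L: "\<And>u. Ck_on k S (\<lambda>y. L y u)" and P: "Ck_on k S P"
  shows "Ck_on k S (\<lambda>y. L y (P y))"
proof -
  have "Ck_on k S (\<lambda>y. \<Sum>b\<in>Basis. (P y \<bullet> b) *\<^sub>R L y b)"
    by (intro Ck_on_sum[OF op] Ck_on_scaleR[OF op] Ck_on_linear[OF op bounded_linear_inner_left] L P)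
  then show ?thesis
    by (subst Ck_on_cong[OF op]) (auto intro: linear_basis_expansion lin)
qed

lemma smooth_on_apply:
  fixes L :: "'e::euclidean_space \<Rightarrow> 'e \<Rightarrow> 'f::real_normed_vector"
  shows "open S \<Longrightarrow> (\<And>y. y \<in> S \<Longrightarrow> linear (L y)) \<Longrightarrow> (\<And>u. smooth_on S (\<lambda>y. L y u)) \<Longrightarrow>
    smooth_on S P \<Longrightarrow> smooth_on S (\<lambda>y. L y (P y))"
  by (simp add: smooth_on_def Ck_on_apply)

lemma dir_deriv_apply:
  fixes L :: "'e::euclidean_space \<Rightarrow> 'e \<Rightarrow> 'f::real_normed_vector"
  assumes op: "open S" and lin: "\<And>y. y \<in> S \<Longrightarrow> linear (L y)"
    and L: "\<And>u. (\<lambda>y. L y u) differentiable (at x)" and P: "P differentiable (at x)" and x: "x \<in> S"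
  shows "dir_deriv (\<lambda>y. L y (P y)) x v = dir_deriv (\<lambda>y. L y (P x)) x v + L x (dir_deriv P x v)"
proof -
  have e: "dir_deriv (\<lambda>y. L y (Q y)) x v =
      (\<Sum>b\<in>Basis. (Q x \<bullet> b) *\<^sub>R dir_deriv (\<lambda>y. L y b) x v) + L x (dir_deriv Q x v)"
    if Q: "Q differentiable (at x)" for Q
  proof -
    have "((\<lambda>y. \<Sum>b\<in>Basis. (Q y \<bullet> b) *\<^sub>R L y b) has_derivative
        (\<lambda>v. \<Sum>b\<in>Basis. (Q x \<bullet> b) *\<^sub>R dir_deriv (\<lambda>y. L y b) x v + (dir_deriv Q x v \<bullet> b) *\<^sub>R L x b)) (at x)"
      by (intro has_derivative_sum has_derivative_scaleR has_derivative_inner_left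
          has_derivative_dir_deriv L Q)
    then have "((\<lambda>y. L y (Q y)) has_derivative
        (\<lambda>v. \<Sum>b\<in>Basis. (Q x \<bullet> b) *\<^sub>R dir_deriv (\<lambda>y. L y b) x v + (dir_deriv Q x v \<bullet> b) *\<^sub>R L x b)) (at x)"
      by (rule has_derivative_transform_within_open[OF _ op x])
        (auto intro: linear_basis_expansion[symmetric] lin)
    from dir_deriv_eq[OF this, of v] show ?thesis
      by (simp add: sum.distrib linear_basis_expansion[OF lin[OF x], symmetric])
  qed
  show ?thesis using e[OF P] e[OF differentiable_const, of "P x"] linear_0[OF lin[OF x]] by simp
qed

lemma linear_dir_deriv_parameter:
  assumes op: "open S" and lin: "\<And>y. y \<in> S \<Longrightarrow> linear (L y)"
    and L: "\<And>u. (\<lambda>y. L y u) differentiable (at x)" and x: "x \<in> S"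
  shows "linear (\<lambda>u. dir_deriv (\<lambda>y. L y u) x v)"
proof (rule linearI)
  fix a b and r :: real
  have "((\<lambda>y. L y (a + b)) has_derivative (\<lambda>v. dir_deriv (\<lambda>y. L y a) x v + dir_deriv (\<lambda>y. L y b) x v)) (at x)"
    by (rule has_derivative_transform_within_open[OF _ op x, of "\<lambda>y. L y a + L y b"])
      (auto intro!: has_derivative_add has_derivative_dir_deriv L simp: linear_add[OF lin])
  then show "dir_deriv (\<lambda>y. L y (a + b)) x v = dir_deriv (\<lambda>y. L y a) x v + dir_deriv (\<lambda>y. L y b) x v"
    by (rule dir_deriv_eq)
  have "((\<lambda>y. L y (r *\<^sub>R a)) has_derivative (\<lambda>v. r *\<^sub>R dir_deriv (\<lambda>y. L y a) x v)) (at x)"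
    by (rule has_derivative_transform_within_open[OF _ op x, of "\<lambda>y. r *\<^sub>R L y a"])
      (auto intro!: has_derivative_scaleR_right has_derivative_dir_deriv L simp: linear_scale[OF lin])
  then show "dir_deriv (\<lambda>y. L y (r *\<^sub>R a)) x v = r *\<^sub>R dir_deriv (\<lambda>y. L y a) x v"
    by (rule dir_deriv_eq)
qed

section \<open>Symmetry of second derivatives\<close>

lemma has_real_derivative_along_line:
  fixes f :: "'e::real_normed_vector \<Rightarrow> real"
  assumes "f differentiable (at (p + t *\<^sub>R u))"
  shows "((\<lambda>t. f (p + t *\<^sub>R u)) has_real_derivative dir_deriv f (p + t *\<^sub>R u) u) (at t)"
proof -
  have 1: "(f has_derivative dir_deriv f (p + t *\<^sub>R u)) (at (p + t *\<^sub>R u))"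
    using assms by (rule has_derivative_dir_deriv)
  have "((\<lambda>t. p + t *\<^sub>R u) has_derivative (\<lambda>h. h *\<^sub>R u)) (at t)"
    by (auto intro!: derivative_eq_intros)
  from has_derivative_compose[OF this 1]
  have "((\<lambda>t. f (p + t *\<^sub>R u)) has_derivative (\<lambda>h. dir_deriv f (p + t *\<^sub>R u) (h *\<^sub>R u))) (at t)" .
  moreover have "dir_deriv f (p + t *\<^sub>R u) (h *\<^sub>R u) = dir_deriv f (p + t *\<^sub>R u) u * h" for h
    using linear_scale[OF linear_frechet_derivative[OF assms]] by simp
  ultimately show ?thesis by (simp add: has_field_derivative_def)
qed

text \<open>
The second difference over the parallelogram spanned by \<open>s u\<close> and \<open>s v\<close> does not change when \<open>u\<close> and \<open>v\<close>
are exchanged. Two applications of the mean value theorem, first along \<open>u\<close> and then along \<open>v\<close>, turn it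
into \<open>s\<^sup>2\<close> times a mixed derivative at some point of the parallelogram; so at \<open>x\<close>
both mixed derivatives are the limit of the same quotient as \<open>s\<close> tends to zero.
\<close>

lemma second_difference_mvt:
  fixes f :: "'e::real_normed_vector \<Rightarrow> real"
  assumes sm: "smooth_on S f" and s: "s > 0"
    and box: "\<And>a b. 0 \<le> a \<Longrightarrow> a \<le> s \<Longrightarrow> 0 \<le> b \<Longrightarrow> b \<le> s \<Longrightarrow> x + a *\<^sub>R u + b *\<^sub>R v \<in> S"
  shows "\<exists>a b. 0 \<le> a \<and> a \<le> s \<and> 0 \<le> b \<and> b \<le> s \<and>
    f (x + s *\<^sub>R u + s *\<^sub>R v) - f (x + s *\<^sub>R u) - f (x + s *\<^sub>R v) + f x
      = s * (s * dir_deriv (\<lambda>y. dir_deriv f y u) (x + a *\<^sub>R u + b *\<^sub>R v) v)"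
proof -
  define F where "F t = f ((x + s *\<^sub>R v) + t *\<^sub>R u) - f (x + t *\<^sub>R u)" for t
  have in1: "x + t *\<^sub>R u \<in> S" "(x + s *\<^sub>R v) + t *\<^sub>R u \<in> S" if "0 \<le> t" "t \<le> s" for t
    using box[of t 0] box[of t s] that s by (simp_all add: algebra_simps)
  have "\<exists>a>0. a < s \<and> F s - F 0 =
      (s - 0) * (dir_deriv f ((x + s *\<^sub>R v) + a *\<^sub>R u) u - dir_deriv f (x + a *\<^sub>R u) u)"
    unfolding F_def
    by (rule MVT2[OF s]) (intro DERIV_diff has_real_derivative_along_line smooth_on_differentiable[OF sm] in1; simp)
  then obtain a where a: "0 < a" "a < s" "F s - F 0 =
      s * (dir_deriv f ((x + s *\<^sub>R v) + a *\<^sub>R u) u - dir_deriv f (x + a *\<^sub>R u) u)" by auto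
  have "\<exists>b>0. b < s \<and> dir_deriv f ((x + a *\<^sub>R u) + s *\<^sub>R v) u - dir_deriv f ((x + a *\<^sub>R u) + 0 *\<^sub>R v) u =
      (s - 0) * dir_deriv (\<lambda>y. dir_deriv f y u) ((x + a *\<^sub>R u) + b *\<^sub>R v) v"
    using a
    by (intro MVT2[OF s] has_real_derivative_along_line[of "\<lambda>y. dir_deriv f y u"]
        smooth_on_differentiable[OF smooth_on_deriv[OF sm]] box) auto
  then obtain b where b: "0 < b" "b < s"
      "dir_deriv f ((x + a *\<^sub>R u) + s *\<^sub>R v) u - dir_deriv f (x + a *\<^sub>R u) u =
      s * dir_deriv (\<lambda>y. dir_deriv f y u) ((x + a *\<^sub>R u) + b *\<^sub>R v) v" by auto
  have "x + s *\<^sub>R v + a *\<^sub>R u = x + a *\<^sub>R u + s *\<^sub>R v" "x + s *\<^sub>R v + s *\<^sub>R u = x + s *\<^sub>R u + s *\<^sub>R v"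
    by (simp_all add: algebra_simps)
  with a b show ?thesis unfolding F_def by (intro exI[of _ a] exI[of _ b]) (auto simp: algebra_simps)
qed

lemma second_difference_limit:
  fixes f :: "'e::real_normed_vector \<Rightarrow> real"
  assumes op: "open S" and sm: "smooth_on S f" and x: "x \<in> S" and e: "e > 0"
  shows "\<exists>d>0. \<forall>s. 0 < s \<and> s < d \<longrightarrow>
    \<bar>(f (x + s *\<^sub>R u + s *\<^sub>R v) - f (x + s *\<^sub>R u) - f (x + s *\<^sub>R v) + f x) / (s * s)
      - dir_deriv (\<lambda>y. dir_deriv f y u) x v\<bar> < e"
proof -
  let ?h = "\<lambda>y. dir_deriv (\<lambda>y. dir_deriv f y u) y v"
  have "continuous_on S ?h" by (intro smooth_on_continuous smooth_on_deriv sm)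
  then have "isCont ?h x" using op x by (simp add: continuous_on_eq_continuous_at)
  then obtain d1 where d1: "d1 > 0" "\<And>y. dist y x < d1 \<Longrightarrow> \<bar>?h y - ?h x\<bar> < e"
    unfolding continuous_at_eps_delta using e by (auto simp: dist_real_def)
  obtain d2 where d2: "d2 > 0" "\<And>y. dist y x < d2 \<Longrightarrow> y \<in> S"
    using op x unfolding open_dist by blast
  \<comment> \<open>For s < ?m / ?N the whole parallelogram lies within distance ?m of x.\<close>
  let ?m = "min d1 d2" and ?N = "norm u + norm v + 1"
  have N: "?N > 0" using norm_ge_zero[of u] norm_ge_zero[of v] by linarith
  have m: "?m > 0" using d1 d2 by simp
  have close: "dist (x + a *\<^sub>R u + b *\<^sub>R v) x < ?m"
    if "0 \<le> a" "a \<le> s" "0 \<le> b" "b \<le> s" "s < ?m / ?N" for a b s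
  proof -
    have "dist (x + a *\<^sub>R u + b *\<^sub>R v) x = norm (a *\<^sub>R u + b *\<^sub>R v)" by (simp add: dist_norm)
    also have "\<dots> \<le> norm (a *\<^sub>R u) + norm (b *\<^sub>R v)" by (rule norm_triangle_ineq)
    also have "\<dots> \<le> s * norm u + s * norm v"
      using that by (intro add_mono) (auto intro: mult_right_mono)
    also have "\<dots> \<le> s * ?N" using that by (simp add: algebra_simps)
    also have "\<dots> < ?m" using that(5) N by (simp add: pos_less_divide_eq)
    finally show ?thesis .
  qed
  show ?thesis
  proof (intro exI[of _ "?m / ?N"] conjI allI impI)
    show "?m / ?N > 0" using m N by simp
    fix s assume s: "0 < s \<and> s < ?m / ?N"
    then have s0: "s > 0" by simp
    have "x + a *\<^sub>R u + b *\<^sub>R v \<in> S" if "0 \<le> a" "a \<le> s" "0 \<le> b" "b \<le> s" for a b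
      using close[OF that] s d2(2) by auto
    from second_difference_mvt[OF sm s0 this] obtain a b where
      ab: "0 \<le> a" "a \<le> s" "0 \<le> b" "b \<le> s"
        "f (x + s *\<^sub>R u + s *\<^sub>R v) - f (x + s *\<^sub>R u) - f (x + s *\<^sub>R v) + f x
          = s * (s * ?h (x + a *\<^sub>R u + b *\<^sub>R v))" by auto
    then show "\<bar>(f (x + s *\<^sub>R u + s *\<^sub>R v) - f (x + s *\<^sub>R u) - f (x + s *\<^sub>R v) + f x) / (s * s)
      - ?h x\<bar> < e"
      using d1(2) close[OF ab(1-4)] s by auto
  qed
qed

lemma second_derivative_symmetric_real:
  fixes f :: "'e::real_normed_vector \<Rightarrow> real"
  assumes op: "open S" and sm: "smooth_on S f" and x: "x \<in> S"
  shows "dir_deriv (\<lambda>y. dir_deriv f y u) x v = dir_deriv (\<lambda>y. dir_deriv f y v) x u" (is "?a = ?b")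
proof (rule ccontr)
  assume "?a \<noteq> ?b"
  then have e: "\<bar>?a - ?b\<bar> / 2 > 0" by simp
  let ?q = "\<lambda>s. (f (x + s *\<^sub>R u + s *\<^sub>R v) - f (x + s *\<^sub>R u) - f (x + s *\<^sub>R v) + f x) / (s * s)"
  have sw: "(f (x + s *\<^sub>R v + s *\<^sub>R u) - f (x + s *\<^sub>R v) - f (x + s *\<^sub>R u) + f x) / (s * s) = ?q s" for s
    by (simp add: algebra_simps)
  obtain d1 where d1: "d1 > 0" "\<And>s. 0 < s \<and> s < d1 \<Longrightarrow> \<bar>?q s - ?a\<bar> < \<bar>?a - ?b\<bar> / 2"
    using second_difference_limit[OF op sm x e, of u v] by blast
  obtain d2 where d2: "d2 > 0" "\<And>s. 0 < s \<and> s < d2 \<Longrightarrow> \<bar>?q s - ?b\<bar> < \<bar>?a - ?b\<bar> / 2"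
    using second_difference_limit[OF op sm x e, of v u] unfolding sw by blast
  have "0 < min d1 d2 / 2 \<and> min d1 d2 / 2 < d1 \<and> min d1 d2 / 2 < d2" using d1(1) d2(1) by auto
  with d1(2)[of "min d1 d2 / 2"] d2(2)[of "min d1 d2 / 2"] show False by argo
qed

lemma second_derivative_symmetric:
  fixes f :: "'e::real_normed_vector \<Rightarrow> 'f::euclidean_space"
  assumes op: "open S" and sm: "smooth_on S f" and x: "x \<in> S"
  shows "dir_deriv (\<lambda>y. dir_deriv f y u) x v = dir_deriv (\<lambda>y. dir_deriv f y v) x u"
proof (rule euclidean_eqI)
  fix b :: 'f assume "b \<in> Basis"
  have "dir_deriv (\<lambda>y. dir_deriv f y u) x v \<bullet> b = dir_deriv (\<lambda>y. dir_deriv (\<lambda>z. f z \<bullet> b) y u) x v" for u v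
  proof -
    have "dir_deriv (\<lambda>y. dir_deriv f y u) x v \<bullet> b = dir_deriv (\<lambda>y. dir_deriv f y u \<bullet> b) x v"
      by (simp add: dir_deriv_inner[OF smooth_on_deriv[OF sm] x])
    also have "\<dots> = dir_deriv (\<lambda>y. dir_deriv (\<lambda>z. f z \<bullet> b) y u) x v"
      by (rule fun_cong[OF dir_deriv_cong[OF op x]])
        (auto simp: dir_deriv_inner[OF sm] intro: smooth_on_differentiable[OF smooth_on_inner[OF op smooth_on_deriv[OF sm]] x])
    finally show ?thesis .
  qed
  then show "dir_deriv (\<lambda>y. dir_deriv f y u) x v \<bullet> b = dir_deriv (\<lambda>y. dir_deriv f y v) x u \<bullet> b"
    using second_derivative_symmetric_real[OF op smooth_on_inner[OF op sm] x] by simp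
qed

section \<open>Inner products, orthonormal frames and traces\<close>

text \<open>
The metric at a point is a scalar product different from the one of the type, so orthonormal
frames and the Riesz representation are developed for an arbitrary positive definite form.
\<close>

locale inner_form =
  fixes h :: "'e::euclidean_space \<Rightarrow> 'e \<Rightarrow> real"
  assumes bilinear: "bilinear h" and sym: "h u v = h v u" and pos: "u \<noteq> 0 \<Longrightarrow> h u u > 0"
begin

lemmas bilinear_simps = bilinear_ladd[OF bilinear] bilinear_radd[OF bilinear] bilinear_lsub[OF bilinear]
  bilinear_rsub[OF bilinear] bilinear_lmul[OF bilinear] bilinear_rmul[OF bilinear]
  bilinear_lneg[OF bilinear] bilinear_rneg[OF bilinear]
  bilinear_lzero[OF bilinear] bilinear_rzero[OF bilinear]

lemma linear_left: "linear (\<lambda>u. h u v)" and linear_right: "linear (h u)"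
  using bilinear by (auto simp: bilinear_def)

lemma sum_left: "h (sum f I) v = (\<Sum>i\<in>I. h (f i) v)"
  by (rule linear_sum[OF linear_left])

lemma nonneg: "h u u \<ge> 0"
  by (cases "u = 0") (auto simp: bilinear_simps dest: pos)

lemma eqI: assumes "\<And>z. h u z = h v z" shows "u = v"
  using assms[of "u - v"] pos[of "u - v"] by (force simp: bilinear_simps)

definition orthonormal :: "'e set \<Rightarrow> bool"
  where "orthonormal E \<longleftrightarrow> finite E \<and> (\<forall>e\<in>E. \<forall>f\<in>E. h e f = (if e = f then 1 else 0))"

lemma orthonormal_coefficient:
  assumes "orthonormal E" "f \<in> E"
  shows "h (\<Sum>e\<in>E. c e *\<^sub>R e) f = c f"
proof -
  have "h (\<Sum>e\<in>E. c e *\<^sub>R e) f = (\<Sum>e\<in>E. c e * (if e = f then 1 else 0))"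
    using assms by (simp add: sum_left bilinear_simps orthonormal_def)
  then show ?thesis using assms by (simp add: orthonormal_def if_distrib cong: if_cong)
qed

lemma orthonormal_card:
  assumes "orthonormal E" shows "card E \<le> DIM('e)"
proof -
  have "independent E"
    unfolding independent_explicit_finite_subsets
  proof (intro allI impI ballI)
    fix F c e assume F: "F \<subseteq> E" "finite F" "(\<Sum>v\<in>F. c v *\<^sub>R v) = 0" "e \<in> F"
    then have "orthonormal F" using assms unfolding orthonormal_def by blast
    from orthonormal_coefficient[OF this F(4), of c] F(3) show "c e = 0" by (simp add: bilinear_simps)
  qed
  then show ?thesis by (rule independent_card_le)
qed

definition frame :: "'e set \<Rightarrow> bool"
  where "frame E \<longleftrightarrow> orthonormal E \<and> (\<forall>u. (\<Sum>e\<in>E. h u e *\<^sub>R e) = u)"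

lemma frameD:
  assumes "frame E"
  shows "orthonormal E" "(\<Sum>e\<in>E. h u e *\<^sub>R e) = u"
  using assms by (simp_all add: frame_def)

text \<open>
An orthonormal set of largest cardinality is a frame: a nonzero remainder \<open>w\<close> of the expansion of
some \<open>u\<close> would, after normalization, enlarge it.
\<close>

lemma frame_exists: "\<exists>E. frame E"
proof -
  have "orthonormal {}" by (simp add: orthonormal_def)
  then obtain E where E: "orthonormal E" and mx: "\<And>F. orthonormal F \<Longrightarrow> card F \<le> card E"
    using ex_has_greatest_nat[of orthonormal "{}" card "Suc DIM('e)"] orthonormal_card
    by (auto simp: less_Suc_eq_le)
  have "(\<Sum>e\<in>E. h u e *\<^sub>R e) = u" for u
  proof (rule ccontr)
    assume ne: "(\<Sum>e\<in>E. h u e *\<^sub>R e) \<noteq> u"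
    define w where "w = u - (\<Sum>e\<in>E. h u e *\<^sub>R e)"
    define q where "q = w /\<^sub>R sqrt (h w w)"
    have ww: "h w w > 0" using ne pos by (simp add: w_def)
    have w0: "h w e = 0" if "e \<in> E" for e
      using orthonormal_coefficient[OF E that, of "h u"] by (simp add: w_def bilinear_simps)
    have qq: "h q q = 1" using ww real_sqrt_mult_self[of "h w w"] by (simp add: q_def bilinear_simps field_simps)
    have q0: "h q e = 0" "h e q = 0" if "e \<in> E" for e
      using w0[OF that] sym[of e w] by (simp_all add: q_def bilinear_simps)
    have "q \<notin> E" using q0 qq by force
    moreover have "orthonormal (insert q E)"
      using E qq q0 by (auto simp: orthonormal_def)
    ultimately show False using mx[of "insert q E"] E by (simp add: orthonormal_def)
  qed
  with E show ?thesis by (auto simp: frame_def)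
qed

lemma riesz:
  assumes "linear k" shows "\<exists>w. \<forall>z. h w z = k z"
proof -
  obtain E where "frame E" using frame_exists by blast
  note E = frameD[OF this]
  have "h (\<Sum>e\<in>E. k e *\<^sub>R e) z = k z" for z
  proof -
    have "h (\<Sum>e\<in>E. k e *\<^sub>R e) z = (\<Sum>e\<in>E. k e * h z e)"
      by (simp add: sum_left bilinear_simps sym[of z])
    also have "\<dots> = k (\<Sum>e\<in>E. h z e *\<^sub>R e)"
      by (simp add: linear_sum[OF assms] linear_scale[OF assms] mult.commute)
    finally show ?thesis by (simp add: E)
  qed
  then show ?thesis by blast
qed

text \<open>
The trace is defined through the standard basis of the type, so it is this formula that links it with
metric contractions.
\<close>

lemma endo_trace_frame:
  assumes L: "linear L" and E: "frame E"
  shows "endo_trace L = (\<Sum>e\<in>E. h (L e) e)"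
proof -
  have "endo_trace L = (\<Sum>b\<in>Basis. (\<Sum>e\<in>E. h (L b) e *\<^sub>R e) \<bullet> b)"
    by (simp add: endo_trace_def frameD(2)[OF E])
  also have "\<dots> = (\<Sum>b\<in>Basis. \<Sum>e\<in>E. h (L b) e * (e \<bullet> b))"
    by (simp add: inner_sum_left)
  also have "\<dots> = (\<Sum>e\<in>E. \<Sum>b\<in>Basis. h (L b) e * (e \<bullet> b))"
    by (rule sum.swap)
  also have "\<dots> = (\<Sum>e\<in>E. h (L (\<Sum>b\<in>Basis. (e \<bullet> b) *\<^sub>R b)) e)"
    by (simp add: linear_sum[OF L] linear_scale[OF L] sum_left bilinear_simps mult.commute)
  finally show ?thesis by (simp add: euclidean_representation)
qed

text \<open>
For self-adjoint \<open>L\<close>, in an orthonormal frame, \<open>tr (L\<^sup>2)\<close> is the sum of the squared lengths of the \<open>L e\<close>.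
\<close>

lemma endo_trace_square_pos:
  assumes L: "linear L" and self: "\<And>u v. h (L u) v = h u (L v)" and "L \<noteq> (\<lambda>u. 0)"
  shows "endo_trace (\<lambda>u. L (L u)) > 0"
proof -
  obtain E where fr: "frame E" using frame_exists by blast
  note E = frameD[OF fr]
  have L2: "linear (\<lambda>u. L (L u))" using linear_compose[OF L L] by (simp add: o_def)
  have tr: "endo_trace (\<lambda>u. L (L u)) = (\<Sum>e\<in>E. h (L e) (L e))"
    by (simp add: endo_trace_frame[OF L2 fr] self)
  have "\<exists>e\<in>E. L e \<noteq> 0"
  proof (rule ccontr)
    assume "\<not> ?thesis"
    then have "L (\<Sum>e\<in>E. h u e *\<^sub>R e) = 0" for u
      by (simp add: linear_sum[OF L] linear_scale[OF L])
    then show False using assms(3) by (simp add: E(2) fun_eq_iff)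
  qed
  then show ?thesis unfolding tr using E(1) pos nonneg
    by (metis (no_types, lifting) orthonormal_def sum_pos2)
qed

end

lemma endo_trace_add: "endo_trace (\<lambda>u. L u + M u) = endo_trace L + endo_trace M"
  and endo_trace_diff: "endo_trace (\<lambda>u. L u - M u) = endo_trace L - endo_trace M"
  and endo_trace_minus: "endo_trace (\<lambda>u. - L u) = - endo_trace L"
  and endo_trace_scale: "endo_trace (\<lambda>u. r *\<^sub>R L u) = r * endo_trace L"
  by (simp_all add: endo_trace_def inner_add_left inner_diff_left sum.distrib sum_subtractf
      sum_negf sum_distrib_left)

lemma endo_trace_ident: "endo_trace (\<lambda>u::'e::euclidean_space. u) = DIM('e)"
  by (simp add: endo_trace_def)

lemma endo_trace_rank_one:
  fixes a :: "'e::euclidean_space"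
  assumes "linear f" shows "endo_trace (\<lambda>u. f u *\<^sub>R a) = f a"
  using linear_basis_expansion[OF assms, of a] by (simp add: endo_trace_def mult.commute)

lemma endo_trace_commute:
  fixes L M :: "'e::euclidean_space \<Rightarrow> 'e"
  assumes "linear L" "linear M"
  shows "endo_trace (\<lambda>u. L (M u)) = endo_trace (\<lambda>u. M (L u))"
proof -
  have e: "L (M b) \<bullet> b = (\<Sum>c\<in>Basis. (M b \<bullet> c) * (L c \<bullet> b))" if "linear L" for L M :: "'e \<Rightarrow> 'e" and b
    by (subst linear_basis_expansion[OF that]) (simp add: inner_sum_left)
  have "endo_trace (\<lambda>u. L (M u)) = (\<Sum>b\<in>Basis. \<Sum>c\<in>Basis. (M b \<bullet> c) * (L c \<bullet> b))"
    by (simp add: endo_trace_def e[OF assms(1)])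
  also have "\<dots> = (\<Sum>c\<in>Basis. \<Sum>b\<in>Basis. (M b \<bullet> c) * (L c \<bullet> b))" by (rule sum.swap)
  also have "\<dots> = endo_trace (\<lambda>u. M (L u))"
    by (simp add: endo_trace_def e[OF assms(2)] mult.commute)
  finally show ?thesis .
qed

section \<open>Smooth dependence of the Riesz representative\<close>

text \<open>
Where the differentiable factor vanishes, continuity of the other factor is enough: the derivative of
the product is \<open>a x\<close> times the derivative of \<open>d\<close>, since \<open>(a - a x) d\<close> is of order \<open>o(\<bar>y - x\<bar>)\<close>.
\<close>

lemma differentiable_mult_vanishing:
  fixes a d :: "'e::real_normed_vector \<Rightarrow> real"
  assumes a: "isCont a x" and d: "d differentiable (at x)" and 0: "d x = 0"
  shows "(\<lambda>y. a y * d y) differentiable (at x)"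
proof -
  define D where "D = dir_deriv d x"
  have D: "(d has_derivative D) (at x)" unfolding D_def by (rule has_derivative_dir_deriv[OF d])
  then have blD: "bounded_linear D" by (rule has_derivative_bounded_linear)
  from bounded_linear.pos_bounded[OF blD] obtain K where K: "K > 0" "\<And>v. norm (D v) \<le> norm v * K" by blast
  have r: "((\<lambda>y. norm (d y - D (y - x)) / norm (y - x)) \<longlongrightarrow> 0) (at x)"
    using D 0 by (simp add: has_derivative_iff_norm)
  have "((\<lambda>y. (a y - a x) * d y) has_derivative (\<lambda>v. 0)) (at x)"
    unfolding has_derivative_iff_norm
  proof
    have "((\<lambda>y. \<bar>a y - a x\<bar> * (norm (d y - D (y - x)) / norm (y - x) + K)) \<longlongrightarrow> \<bar>a x - a x\<bar> * (0 + K)) (at x)"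
      using a by (intro tendsto_intros r) (simp add: isCont_def)
    then have t: "((\<lambda>y. \<bar>a y - a x\<bar> * (norm (d y - D (y - x)) / norm (y - x) + K)) \<longlongrightarrow> 0) (at x)" by simp
    have "eventually (\<lambda>y. norm (norm ((a y - a x) * d y - (a x - a x) * d x - 0) / norm (y - x))
        \<le> \<bar>a y - a x\<bar> * (norm (d y - D (y - x)) / norm (y - x) + K)) (at x)"
      unfolding eventually_at_filter
    proof (rule always_eventually, intro allI impI)
      fix y assume "y \<noteq> x"
      then have p: "norm (y - x) > 0" by simp
      have "\<bar>d y\<bar> \<le> norm (d y - D (y - x)) + norm (D (y - x))" by simp
      also have "\<dots> \<le> norm (d y - D (y - x)) + norm (y - x) * K" using K(2) by simp
      finally have "\<bar>d y\<bar> / norm (y - x) \<le> norm (d y - D (y - x)) / norm (y - x) + K"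
        using p by (simp add: field_simps)
      then have "\<bar>a y - a x\<bar> * (\<bar>d y\<bar> / norm (y - x)) \<le> \<bar>a y - a x\<bar> * (norm (d y - D (y - x)) / norm (y - x) + K)"
        by (rule mult_left_mono) simp
      then show "norm (norm ((a y - a x) * d y - (a x - a x) * d x - 0) / norm (y - x))
        \<le> \<bar>a y - a x\<bar> * (norm (d y - D (y - x)) / norm (y - x) + K)"
        by (simp add: abs_mult)
    qed
    from Lim_null_comparison[OF this t]
    show "((\<lambda>y. norm ((a y - a x) * d y - (a x - a x) * d x - 0) / norm (y - x)) \<longlongrightarrow> 0) (at x)" .
  qed simp
  then have "(\<lambda>y. (a y - a x) * d y) differentiable (at x)" by (rule differentiableI)
  then have "(\<lambda>y. (a y - a x) * d y + a x * d y) differentiable (at x)"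
    by (rule differentiable_add) (intro differentiable_mult differentiable_const d)
  then show ?thesis by (simp add: algebra_simps)
qed

text \<open>
Here \<open>w y\<close> is the vector representing the functional \<open>k y\<close> with respect to the form \<open>h y\<close>. It is shown
to be as regular as \<open>k\<close>, without inverting the Gram matrix: in a frame \<open>E\<close> that is orthonormal for \<open>h x\<close>,
with \<open>x\<close> frozen, the coefficients of \<open>w y\<close> are \<open>k y e\<close> minus a correction whose factors \<open>h y f e - h x f e\<close>
vanish at \<open>y = x\<close>.
\<close>

context
  fixes U :: "'e::euclidean_space set" and h :: "'e \<Rightarrow> 'e \<Rightarrow> 'e \<Rightarrow> real"
  assumes op: "open U" and form: "\<And>y. y \<in> U \<Longrightarrow> inner_form (h y)"
    and smooth: "\<And>u v. smooth_on U (\<lambda>y. h y u v)"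
begin

context
  fixes k :: "'e \<Rightarrow> 'e \<Rightarrow> real" and w :: "'e \<Rightarrow> 'e" and x :: 'e
  assumes x: "x \<in> U" and sol: "\<And>y z. y \<in> U \<Longrightarrow> h y (w y) z = k y z"
begin

lemma frozen_coefficients:
  "\<exists>E. finite E \<and> (\<forall>y. w y = (\<Sum>e\<in>E. h x (w y) e *\<^sub>R e)) \<and>
    (\<forall>y\<in>U. \<forall>e. h x (w y) e = k y e - (\<Sum>f\<in>E. h x (w y) f * (h y f e - h x f e)))"
proof -
  interpret x: inner_form "h x" by (rule form[OF x])
  obtain E where "x.frame E" using x.frame_exists by blast
  note E = x.frameD[OF this]
  have c: "h x (w y) e = k y e - (\<Sum>f\<in>E. h x (w y) f * (h y f e - h x f e))" if y: "y \<in> U" for y e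
  proof -
    interpret y: inner_form "h y" by (rule form[OF y])
    have "k y e = h y (\<Sum>f\<in>E. h x (w y) f *\<^sub>R f) e" by (simp add: E(2) sol[OF y])
    moreover have "h x (w y) e = h x (\<Sum>f\<in>E. h x (w y) f *\<^sub>R f) e" by (simp add: E(2))
    ultimately show ?thesis
      by (simp add: x.sum_left y.sum_left x.bilinear_simps y.bilinear_simps right_diff_distrib sum_subtractf)
  qed
  have f: "finite E" using E(1) by (simp add: x.orthonormal_def)
  show ?thesis by (intro exI[of _ E] conjI ballI allI f c E(2)[symmetric])
qed

text \<open>
Let \<open>A y\<close> be the \<open>l\<^sup>1\<close> norm of the coefficients. The equation for the coefficients gives
\<open>A y \<le> K y + A y * d y\<close> with \<open>d y\<close> tending to zero; so \<open>A\<close> stays bounded near \<open>x\<close>, and the corrections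
tend to zero.
\<close>

lemma solution_continuous:
  assumes k: "\<And>z. isCont (\<lambda>y. k y z) x"
  shows "isCont w x"
proof -
  obtain E where E0: "finite E" "\<forall>y. w y = (\<Sum>e\<in>E. h x (w y) e *\<^sub>R e)"
    "\<forall>y\<in>U. \<forall>e. h x (w y) e = k y e - (\<Sum>f\<in>E. h x (w y) f * (h y f e - h x f e))"
    using frozen_coefficients by (elim exE conjE) (rule that)
  note E = E0(1) E0(2)[THEN spec] E0(3)[THEN bspec, THEN spec]
  define a where "a y e = h x (w y) e" for y e
  define A where "A y = (\<Sum>e\<in>E. \<bar>a y e\<bar>)" for y
  define d where "d y = (\<Sum>e\<in>E. \<Sum>f\<in>E. \<bar>h y f e - h x f e\<bar>)" for y
  define K where "K y = (\<Sum>e\<in>E. \<bar>k y e\<bar>)" for y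
  have hc: "((\<lambda>y. h y u v) \<longlongrightarrow> h x u v) (at x)" for u v
    using smooth_on_continuous[OF smooth, of u v] op x
    by (simp add: continuous_on_eq_continuous_at isCont_def)
  have "(d \<longlongrightarrow> (\<Sum>e\<in>E. \<Sum>f\<in>E. \<bar>h x f e - h x f e\<bar>)) (at x)"
    unfolding d_def by (intro tendsto_intros hc)
  then have d0: "(d \<longlongrightarrow> 0) (at x)" by simp
  have K0: "(K \<longlongrightarrow> K x) (at x)"
    unfolding K_def using k by (intro tendsto_intros) (simp add: isCont_def)
  have Kx: "K x \<ge> 0" by (simp add: K_def sum_nonneg)
  have evU: "eventually (\<lambda>y. y \<in> U) (at x)" by (rule eventually_at_in_open'[OF op x])
  have err: "\<bar>\<Sum>f\<in>E. a y f * (h y f e - h x f e)\<bar> \<le> A y * (\<Sum>f\<in>E. \<bar>h y f e - h x f e\<bar>)" for y e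
  proof -
    have "\<bar>\<Sum>f\<in>E. a y f * (h y f e - h x f e)\<bar> \<le> (\<Sum>f\<in>E. \<bar>a y f\<bar> * \<bar>h y f e - h x f e\<bar>)"
      by (rule order_trans[OF sum_abs]) (simp add: abs_mult)
    also have "\<dots> \<le> (\<Sum>f\<in>E. A y * \<bar>h y f e - h x f e\<bar>)"
      unfolding A_def using E(1) by (intro sum_mono mult_right_mono member_le_sum) auto
    finally show ?thesis by (simp add: sum_distrib_left)
  qed
  have A1: "A y \<le> K y + A y * d y" if "y \<in> U" for y
  proof -
    have "A y \<le> (\<Sum>e\<in>E. \<bar>k y e\<bar> + A y * (\<Sum>f\<in>E. \<bar>h y f e - h x f e\<bar>))"
      unfolding A_def[of y]
    proof (rule sum_mono)
      fix e
      show "\<bar>a y e\<bar> \<le> \<bar>k y e\<bar> + (\<Sum>e\<in>E. \<bar>a y e\<bar>) * (\<Sum>f\<in>E. \<bar>h y f e - h x f e\<bar>)"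
        using E(3)[OF that, of e] err[of y e] unfolding a_def[symmetric] A_def[symmetric] by linarith
    qed
    then show ?thesis by (simp add: sum.distrib K_def d_def sum_distrib_left)
  qed
  have evA: "eventually (\<lambda>y. A y \<le> 2 * (K x + 1)) (at x)"
  proof -
    have e1: "eventually (\<lambda>y. d y < 1/2) (at x)" using order_tendstoD(2)[OF d0, of "1/2"] by simp
    have e2: "eventually (\<lambda>y. K y < K x + 1) (at x)" using order_tendstoD(2)[OF K0, of "K x + 1"] by simp
    show ?thesis using e1 e2 evU
    proof eventually_elim
      case (elim y)
      have "A y * d y \<le> A y * (1/2)" using elim by (intro mult_left_mono) (auto simp: A_def sum_nonneg)
      with A1[OF elim(3)] elim(2) show ?case by simp
    qed
  qed
  have at: "((\<lambda>y. a y e) \<longlongrightarrow> k x e) (at x)" if e: "e \<in> E" for e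
  proof -
    have "((\<lambda>y. a y e - k y e) \<longlongrightarrow> 0) (at x)"
    proof (rule Lim_null_comparison)
      show "((\<lambda>y. 2 * (K x + 1) * d y) \<longlongrightarrow> 0) (at x)"
        using tendsto_mult_left[OF d0, of "2 * (K x + 1)"] by simp
      show "eventually (\<lambda>y. norm (a y e - k y e) \<le> 2 * (K x + 1) * d y) (at x)"
        using evA evU
      proof eventually_elim
        case (elim y)
        have "norm (a y e - k y e) \<le> A y * (\<Sum>f\<in>E. \<bar>h y f e - h x f e\<bar>)"
          using E(3)[OF elim(2), of e] err[of y e] unfolding a_def[symmetric] by simp
        also have "\<dots> \<le> 2 * (K x + 1) * d y"
        proof (rule mult_mono)
          show "(\<Sum>f\<in>E. \<bar>h y f e - h x f e\<bar>) \<le> d y"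
            unfolding d_def using E(1) e
            by (intro member_le_sum[of e E "\<lambda>e. \<Sum>f\<in>E. \<bar>h y f e - h x f e\<bar>"]) (auto simp: sum_nonneg)
        qed (use elim Kx in \<open>auto simp: sum_nonneg\<close>)
        finally show ?case .
      qed
    qed
    from tendsto_add[OF this k[of e, unfolded isCont_def]] show ?thesis by simp
  qed
  have "a x e = k x e" for e using E(3)[OF x, of e] by (simp add: a_def)
  then have "((\<lambda>y. \<Sum>e\<in>E. a y e *\<^sub>R e) \<longlongrightarrow> (\<Sum>e\<in>E. a x e *\<^sub>R e)) (at x)"
    using at by (intro tendsto_intros) auto
  moreover have "(\<Sum>e\<in>E. a y e *\<^sub>R e) = w y" for y using E(2)[of y] by (simp add: a_def)
  ultimately show ?thesis by (simp add: isCont_def)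
qed

text \<open>
The coefficients of \<open>w\<close> are already continuous, so each product in the correction is differentiable
by \<open>differentiable_mult_vanishing\<close>.
\<close>

lemma solution_differentiable:
  assumes k: "\<And>z. (\<lambda>y. k y z) differentiable (at x)"
  shows "w differentiable (at x)"
proof -
  obtain E where E0: "finite E" "\<forall>y. w y = (\<Sum>e\<in>E. h x (w y) e *\<^sub>R e)"
    "\<forall>y\<in>U. \<forall>e. h x (w y) e = k y e - (\<Sum>f\<in>E. h x (w y) f * (h y f e - h x f e))"
    using frozen_coefficients by (elim exE conjE) (rule that)
  note E = E0(1) E0(2)[THEN spec] E0(3)[THEN bspec, THEN spec]
  interpret x: inner_form "h x" by (rule form[OF x])
  have wc: "isCont w x"
    by (intro solution_continuous differentiable_imp_continuous_within k)
  have ac: "isCont (\<lambda>y. h x (w y) f) x" for f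
    using x.linear_left[of f] wc by (intro isCont_o2[OF wc] linear_continuous_at) (simp add: linear_linear)
  have hd: "(\<lambda>y. h y f e - h x f e) differentiable (at x)" for f e
    by (intro differentiable_diff differentiable_const smooth_on_differentiable[OF smooth x])
  have "(\<lambda>y. k y e - (\<Sum>f\<in>E. h x (w y) f * (h y f e - h x f e))) differentiable (at x)" for e
    by (intro differentiable_diff k differentiable_sum E(1) ballI differentiable_mult_vanishing ac hd) simp
  then have "(\<lambda>y. h x (w y) e) differentiable (at x)" for e
    by (subst differentiable_cong_open[OF op x E(3)])
  then have "(\<lambda>y. \<Sum>e\<in>E. h x (w y) e *\<^sub>R e) differentiable (at x)"
    by (intro differentiable_sum E(1) ballI differentiable_scaleR differentiable_const)
  then show ?thesis using E(2) by (metis (no_types, lifting) ext)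
qed

end

text \<open>
Differentiating \<open>h y (w y) z = k y z\<close> shows that a directional derivative of \<open>w\<close> solves an equation of the
same kind, with right-hand side built from a derivative of \<open>k\<close> and from \<open>w\<close> itself. As \<open>w\<close> is known to be
of class \<open>C\<^sup>m\<close> by induction, so is this right-hand side.
\<close>

lemma solution_Ck:
  assumes "\<And>y z. y \<in> U \<Longrightarrow> h y (w y) z = k y z" and "\<And>z. Ck_on m U (\<lambda>y. k y z)"
  shows "Ck_on m U w"
  using assms
proof (induction m arbitrary: w k)
  case 0
  have "isCont (\<lambda>y. k y z) x" if "x \<in> U" for x z
    using 0(2)[of z] that op by (simp add: continuous_on_eq_continuous_at)
  then have "isCont w x" if "x \<in> U" for x
    using that 0(1) by (intro solution_continuous[where k=k]) auto
  then show ?case using op by (simp add: continuous_on_eq_continuous_at)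
next
  case (Suc m)
  have kd: "(\<lambda>y. k y z) differentiable (at x)" if "x \<in> U" for x z
    using Suc.prems(2) that by simp
  have wd: "w differentiable (at x)" if "x \<in> U" for x
    using that Suc.prems(1) kd by (intro solution_differentiable[where k=k]) auto
  have wm: "Ck_on m U w" by (rule Suc.IH[OF Suc.prems(1) Ck_on_Suc_imp[OF Suc.prems(2)]])
  have "Ck_on m U (\<lambda>x. dir_deriv w x v)" for v
  proof (rule Suc.IH)
    show "h x (dir_deriv w x v) z = dir_deriv (\<lambda>y. k y z) x v - dir_deriv (\<lambda>y. h y (w x) z) x v"
      if x: "x \<in> U" for x z
    proof -
      have "dir_deriv (\<lambda>y. k y z) x = dir_deriv (\<lambda>y. h y (w y) z) x"
        by (rule dir_deriv_cong[OF op x _ kd[OF x]]) (simp add: Suc.prems(1))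
      moreover have "dir_deriv (\<lambda>y. h y (w y) z) x v =
          dir_deriv (\<lambda>y. h y (w x) z) x v + h x (dir_deriv w x v) z"
        by (rule dir_deriv_apply[OF op _ _ wd[OF x] x, of "\<lambda>y u. h y u z"])
          (auto intro: inner_form.linear_left[OF form] smooth_on_differentiable[OF smooth x])
      ultimately show ?thesis by simp
    qed
    fix z
    have "Ck_on m U (\<lambda>x. dir_deriv (\<lambda>y. h y (w x) z) x v)"
    proof (rule Ck_on_apply[OF op _ _ wm])
      show "linear (\<lambda>u. dir_deriv (\<lambda>y. h y u z) x v)" if x: "x \<in> U" for x
        by (rule linear_dir_deriv_parameter[OF op _ _ x, of "\<lambda>y u. h y u z"])
          (auto intro: inner_form.linear_left[OF form] smooth_on_differentiable[OF smooth x])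
      show "Ck_on m U (\<lambda>y. dir_deriv (\<lambda>y. h y u z) y v)" for u
        using smooth_on_deriv[OF smooth] by (simp add: smooth_on_def)
    qed
    with Suc.prems(2)[of z]
    show "Ck_on m U (\<lambda>x. dir_deriv (\<lambda>y. k y z) x v - dir_deriv (\<lambda>y. h y (w x) z) x v)"
      by (intro Ck_on_diff[OF op]) simp_all
  qed
  then show ?case using wd by simp
qed

lemma solution_smooth:
  assumes "\<And>y z. y \<in> U \<Longrightarrow> h y (w y) z = k y z" and "\<And>z. smooth_on U (\<lambda>y. k y z)"
  shows "smooth_on U w"
  using assms by (auto simp: smooth_on_def intro: solution_Ck)

end

section \<open>Levi-Civita connection in a chart\<close>

locale metric_chart =
  fixes g :: "('a, 'e::euclidean_space) tensor2" and c :: "('a, 'e) chart"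
  assumes open_image: "open (chart_image c)"
    and form: "x \<in> chart_image c \<Longrightarrow> inner_form (g c x)"
    and smooth: "smooth_on (chart_image c) (\<lambda>x. g c x u v)"
begin

abbreviation "U \<equiv> chart_image c"
abbreviation "\<Gamma> \<equiv> christoffel g c"
abbreviation "nabla u \<equiv> cov_deriv g c (\<lambda>_. u)"

definition dmetric :: "'e \<Rightarrow> 'e \<Rightarrow> 'e \<Rightarrow> 'e \<Rightarrow> real"
  where "dmetric x w u v = dir_deriv (\<lambda>y. g c y u v) x w"

lemma dmetric_linear:
  assumes x: "x \<in> U"
  shows "linear (\<lambda>w. dmetric x w u v)" "linear (\<lambda>u. dmetric x w u v)" "linear (\<lambda>v. dmetric x w u v)"
  unfolding dmetric_def
  using dir_deriv_linear[OF smooth x]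
    linear_dir_deriv_parameter[OF open_image inner_form.linear_left[OF form] smooth_on_differentiable[OF smooth x] x]
    linear_dir_deriv_parameter[OF open_image inner_form.linear_right[OF form] smooth_on_differentiable[OF smooth x] x]
  by simp_all

lemma dmetric_sym: "x \<in> U \<Longrightarrow> dmetric x w u v = dmetric x w v u"
  unfolding dmetric_def
  by (rule fun_cong[OF dir_deriv_cong[OF open_image]])
    (auto intro: smooth_on_differentiable[OF smooth] inner_form.sym[OF form])

text \<open>
The Riesz representation supplies existence in the definite description that defines the Christoffel
symbols.
\<close>

lemma koszul:
  assumes x: "x \<in> U"
  shows "2 * g c x (\<Gamma> x u v) z = dmetric x u v z + dmetric x v u z - dmetric x z u v"
proof -
  interpret inner_form "g c x" by (rule form[OF x])
  have "linear (\<lambda>z. (dmetric x u v z + dmetric x v u z - dmetric x z u v) / 2)"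
    using dmetric_linear[OF x] by (auto simp: linear_iff field_simps)
  from riesz[OF this] obtain w where
    w0: "\<forall>z. g c x w z = (dmetric x u v z + dmetric x v u z - dmetric x z u v) / 2" by blast
  have w: "2 * g c x w z = dmetric x u v z + dmetric x v u z - dmetric x z u v" for z
    using w0[rule_format, of z] by simp
  have "\<forall>z. 2 * g c x (\<Gamma> x u v) z = dmetric x u v z + dmetric x v u z - dmetric x z u v"
    unfolding christoffel_def dmetric_def[symmetric]
  proof (rule theI[of _ w])
    fix w' assume "\<forall>z. 2 * g c x w' z = dmetric x u v z + dmetric x v u z - dmetric x z u v"
    then have "2 * g c x w' z = 2 * g c x w z" for z by (simp add: w)
    then show "w' = w" by (intro eqI) simp
  qed (simp add: w)
  then show ?thesis by blast
qed

lemma christoffel_sym: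
  assumes x: "x \<in> U" shows "\<Gamma> x u v = \<Gamma> x v u"
proof -
  interpret inner_form "g c x" by (rule form[OF x])
  have "2 * g c x (\<Gamma> x u v) z = 2 * g c x (\<Gamma> x v u) z" for z
    unfolding koszul[OF x] using dmetric_sym[OF x] by simp
  then show ?thesis by (intro eqI) simp
qed

lemma christoffel_linear_right:
  assumes x: "x \<in> U" shows "linear (\<Gamma> x u)"
proof -
  interpret inner_form "g c x" by (rule form[OF x])
  note lin = linear_add[OF dmetric_linear(1)[OF x]] linear_add[OF dmetric_linear(2)[OF x]]
    linear_add[OF dmetric_linear(3)[OF x]] linear_scale[OF dmetric_linear(1)[OF x]]
    linear_scale[OF dmetric_linear(2)[OF x]] linear_scale[OF dmetric_linear(3)[OF x]]
  show ?thesis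
  proof (rule linearI)
    fix a b and r :: real
    have "2 * g c x (\<Gamma> x u (a + b)) z = 2 * g c x (\<Gamma> x u a + \<Gamma> x u b) z" for z
      unfolding bilinear_simps distrib_left koszul[OF x] by (simp add: lin)
    then show "\<Gamma> x u (a + b) = \<Gamma> x u a + \<Gamma> x u b" by (intro eqI) simp
    have "2 * g c x (\<Gamma> x u (r *\<^sub>R a)) z = r * (2 * g c x (\<Gamma> x u a) z)" for z
      unfolding koszul[OF x] by (simp add: lin algebra_simps)
    then show "\<Gamma> x u (r *\<^sub>R a) = r *\<^sub>R \<Gamma> x u a" by (intro eqI) (simp add: bilinear_simps)
  qed
qed

lemma christoffel_linear_left: "x \<in> U \<Longrightarrow> linear (\<lambda>u. \<Gamma> x u v)"
  using christoffel_linear_right[of x v] by (simp add: christoffel_sym[of x _ v])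

lemmas christoffel_linear =
  linear_add[OF christoffel_linear_left] linear_add[OF christoffel_linear_right]
  linear_diff[OF christoffel_linear_left] linear_diff[OF christoffel_linear_right]
  linear_scale[OF christoffel_linear_left] linear_scale[OF christoffel_linear_right]
  linear_0[OF christoffel_linear_left] linear_0[OF christoffel_linear_right]
  linear_neg[OF christoffel_linear_left] linear_neg[OF christoffel_linear_right]

lemma christoffel_smooth: "smooth_on U (\<lambda>x. \<Gamma> x u v)"
proof (rule solution_smooth[OF open_image form smooth])
  show "g c y (\<Gamma> y u v) z = (1/2) *\<^sub>R (dmetric y u v z + dmetric y v u z - dmetric y z u v)"
    if "y \<in> U" for y z using koszul[OF that, of u v z] by simp
  show "smooth_on U (\<lambda>y. (1/2) *\<^sub>R (dmetric y u v z + dmetric y v u z - dmetric y z u v))" for z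
    unfolding dmetric_def
    by (intro smooth_on_scaleR smooth_on_add smooth_on_diff smooth_on_const smooth_on_deriv smooth open_image)
qed

lemma christoffel_smooth_apply: "smooth_on U Z \<Longrightarrow> smooth_on U (\<lambda>x. \<Gamma> x u (Z x))"
  by (rule smooth_on_apply[OF open_image christoffel_linear_right christoffel_smooth])

text \<open>
The connection is metric: adding the Koszul formulas for the two terms on the right, all
derivatives except the one on the left cancel.
\<close>

lemma christoffel_metric:
  assumes x: "x \<in> U"
  shows "dmetric x w u v = g c x (\<Gamma> x w u) v + g c x u (\<Gamma> x w v)"
  using koszul[OF x, of w u v] koszul[OF x, of w v u] inner_form.sym[OF form[OF x], of u]
    dmetric_sym[OF x] by simp

lemma nabla_eq: "nabla u Z x = dir_deriv Z x u + \<Gamma> x u (Z x)"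
  by (simp add: cov_deriv_def)

lemma nabla_const: "nabla u (\<lambda>_. z) x = \<Gamma> x u z"
  by (simp add: cov_deriv_def)

lemma nabla_smooth: "smooth_on U Z \<Longrightarrow> smooth_on U (nabla u Z)"
  unfolding cov_deriv_def
  by (intro smooth_on_add smooth_on_deriv christoffel_smooth_apply open_image)

lemma nabla_diff:
  "smooth_on U Y \<Longrightarrow> smooth_on U Z \<Longrightarrow> x \<in> U \<Longrightarrow> nabla u (\<lambda>y. Y y - Z y) x = nabla u Y x - nabla u Z x"
  by (simp add: nabla_eq dir_deriv_diff[of U] christoffel_linear)

lemma nabla_linear:
  "smooth_on U Z \<Longrightarrow> x \<in> U \<Longrightarrow> linear (\<lambda>u. nabla u Z x)"
  unfolding nabla_eq using dir_deriv_linear[of U Z x] christoffel_linear_left[of x]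
  by (intro linear_compose_add)

lemma nabla_metric:
  assumes P: "smooth_on U P" and Q: "smooth_on U Q" and x: "x \<in> U"
  shows "dir_deriv (\<lambda>y. g c y (P y) (Q y)) x w = g c x (nabla w P x) (Q x) + g c x (P x) (nabla w Q x)"
proof -
  interpret inner_form "g c x" by (rule form[OF x])
  have sP: "smooth_on U (\<lambda>y. g c y (P y) v)" for v
    by (rule smooth_on_apply[OF open_image inner_form.linear_left[OF form] smooth P])
  have "dir_deriv (\<lambda>y. g c y (P y) (Q y)) x w =
      dir_deriv (\<lambda>y. g c y (P y) (Q x)) x w + g c x (P x) (dir_deriv Q x w)"
    by (rule dir_deriv_apply[OF open_image inner_form.linear_right[OF form]
          smooth_on_differentiable[OF sP x] smooth_on_differentiable[OF Q x] x])
  also have "dir_deriv (\<lambda>y. g c y (P y) (Q x)) x w = dmetric x w (P x) (Q x) + g c x (dir_deriv P x w) (Q x)"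
    unfolding dmetric_def
    by (rule dir_deriv_apply[OF open_image inner_form.linear_left[OF form]
          smooth_on_differentiable[OF smooth x] smooth_on_differentiable[OF P x] x])
  finally show ?thesis by (simp add: christoffel_metric[OF x] nabla_eq bilinear_simps)
qed

lemma metric_smooth_apply:
  assumes "smooth_on U P" "smooth_on U Q" shows "smooth_on U (\<lambda>y. g c y (P y) (Q y))"
  by (intro smooth_on_apply[OF open_image inner_form.linear_right[OF form] _ assms(2)]
      smooth_on_apply[OF open_image inner_form.linear_left[OF form] smooth assms(1)])

section \<open>Curvature tensor and second Bianchi identity\<close>

text \<open>
Constant fields commute, so the bracket term of the curvature is absent.
\<close>

definition curv :: "'e \<Rightarrow> 'e \<Rightarrow> 'e \<Rightarrow> 'e \<Rightarrow> 'e"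
  where "curv x u v z = nabla u (nabla v (\<lambda>_. z)) x - nabla v (nabla u (\<lambda>_. z)) x"

lemma curvature_const:
  assumes x: "x \<in> U" shows "curvature g c (\<lambda>_. u) (\<lambda>_. v) (\<lambda>_. z) x = curv x u v z"
  by (simp add: curvature_def curv_def cov_deriv_def lie_bracket_def christoffel_linear[OF x])

lemma ricci_eq: "x \<in> U \<Longrightarrow> ricci g c x u v = endo_trace (\<lambda>w. curv x w u v)"
  by (simp add: ricci_def curvature_const)

lemma curv_eq:
  assumes x: "x \<in> U"
  shows "curv x u v z = dir_deriv (\<lambda>y. \<Gamma> y v z) x u - dir_deriv (\<lambda>y. \<Gamma> y u z) x v
    + \<Gamma> x u (\<Gamma> x v z) - \<Gamma> x v (\<Gamma> x u z)"
  unfolding curv_def nabla_const by (simp add: nabla_eq)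

lemma curv_antisym: "curv x u v z = - curv x v u z"
  by (simp add: curv_def)

lemma curv_smooth: "smooth_on U (\<lambda>x. curv x u v z)"
  unfolding curv_def by (intro smooth_on_diff open_image nabla_smooth smooth_on_const)

lemma
  assumes x: "x \<in> U"
  shows curv_linear1: "linear (\<lambda>u. curv x u v z)"
    and curv_linear2: "linear (\<lambda>v. curv x u v z)"
    and curv_linear3: "linear (curv x u v)"
proof -
  note D = dir_deriv_linear[OF christoffel_smooth x]
  note P = linear_dir_deriv_parameter[OF open_image christoffel_linear_right smooth_on_differentiable[OF christoffel_smooth x] x]
  note Q = linear_dir_deriv_parameter[OF open_image christoffel_linear_left smooth_on_differentiable[OF christoffel_smooth x] x]
  note simps = curv_eq[OF x] christoffel_linear[OF x] linear_add[OF D] linear_add[OF P] linear_add[OF Q]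
    linear_scale[OF D] linear_scale[OF P] linear_scale[OF Q]
  show 1: "linear (\<lambda>u. curv x u v z)" for v
    by (rule linearI) (simp_all add: simps algebra_simps)
  show "linear (\<lambda>v. curv x u v z)"
    by (subst curv_antisym) (intro linear_compose_neg 1)
  show "linear (curv x u v)"
    by (rule linearI) (simp_all add: simps algebra_simps)
qed

text \<open>
The first derivatives of \<open>Z\<close> enter symmetrically in \<open>u\<close> and \<open>v\<close>, and the second derivatives of \<open>Z\<close> cancel
by their symmetry; so the commutator of covariant derivatives depends on \<open>Z x\<close> only.
\<close>

lemma curvature_tensorial:
  assumes Z: "smooth_on U Z" and x: "x \<in> U"
  shows "nabla u (nabla v Z) x - nabla v (nabla u Z) x = curv x u v (Z x)"
proof -
  have e: "nabla u (nabla v Z) x = dir_deriv (\<lambda>y. dir_deriv Z y v) x u + dir_deriv (\<lambda>y. \<Gamma> y v (Z x)) x u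
      + \<Gamma> x v (dir_deriv Z x u) + \<Gamma> x u (dir_deriv Z x v) + \<Gamma> x u (\<Gamma> x v (Z x))" for u v
  proof -
    have "nabla u (nabla v Z) x = dir_deriv (\<lambda>y. dir_deriv Z y v + \<Gamma> y v (Z y)) x u
        + \<Gamma> x u (dir_deriv Z x v + \<Gamma> x v (Z x))"
    proof -
      have "nabla v Z = (\<lambda>y. dir_deriv Z y v + \<Gamma> y v (Z y))" by (simp add: fun_eq_iff nabla_eq)
      then show ?thesis by (simp add: nabla_eq)
    qed
    also have "dir_deriv (\<lambda>y. dir_deriv Z y v + \<Gamma> y v (Z y)) x u =
        dir_deriv (\<lambda>y. dir_deriv Z y v) x u + dir_deriv (\<lambda>y. \<Gamma> y v (Z y)) x u"
      by (rule dir_deriv_add[OF smooth_on_deriv[OF Z] christoffel_smooth_apply[OF Z] x])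
    also have "dir_deriv (\<lambda>y. \<Gamma> y v (Z y)) x u = dir_deriv (\<lambda>y. \<Gamma> y v (Z x)) x u + \<Gamma> x v (dir_deriv Z x u)"
      by (rule dir_deriv_apply[OF open_image christoffel_linear_right
            smooth_on_differentiable[OF christoffel_smooth x] smooth_on_differentiable[OF Z x] x])
    finally show ?thesis by (simp add: christoffel_linear[OF x])
  qed
  show ?thesis
    unfolding e curv_eq[OF x] using second_derivative_symmetric[OF open_image Z x, of u v] by simp
qed

text \<open>
The second derivative of \<open>g(z, z')\<close> along \<open>u\<close> and \<open>v\<close> is symmetric. Expanded by the metric property of
the connection, its change under exchange of \<open>u\<close> and \<open>v\<close> is
\<open>g(R(u, v) z, z') + g(z, R(u, v) z')\<close>, which is therefore zero.
\<close>

lemma curv_skew: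
  assumes x: "x \<in> U"
  shows "g c x (curv x u v z) z' = - g c x z (curv x u v z')"
proof -
  interpret inner_form "g c x" by (rule form[OF x])
  note sc = smooth_on_const[of U]
  note sm = nabla_smooth[OF sc]
  let ?Z = "\<lambda>_::'e. z" and ?Z' = "\<lambda>_::'e. z'"
  have e: "dir_deriv (\<lambda>y. dir_deriv (\<lambda>y. g c y z z') y v) x u
      = g c x (nabla u (nabla v ?Z) x) z' + g c x (nabla v ?Z x) (nabla u ?Z' x)
        + g c x (nabla u ?Z x) (nabla v ?Z' x) + g c x z (nabla u (nabla v ?Z') x)" for u v
  proof -
    have "dir_deriv (\<lambda>y. dir_deriv (\<lambda>y. g c y z z') y v) x u =
        dir_deriv (\<lambda>y. g c y (nabla v ?Z y) z' + g c y z (nabla v ?Z' y)) x u"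
      by (rule fun_cong[OF dir_deriv_cong[OF open_image x]])
        (auto simp: nabla_metric[OF sc sc] intro: smooth_on_differentiable[OF smooth_on_deriv[OF smooth] x])
    also have "\<dots> = dir_deriv (\<lambda>y. g c y (nabla v ?Z y) z') x u + dir_deriv (\<lambda>y. g c y z (nabla v ?Z' y)) x u"
      by (rule dir_deriv_add[OF _ _ x]) (intro metric_smooth_apply sm sc)+
    finally show ?thesis by (simp add: nabla_metric[OF sm sc x] nabla_metric[OF sc sm x])
  qed
  have "dir_deriv (\<lambda>y. dir_deriv (\<lambda>y. g c y z z') y v) x u = dir_deriv (\<lambda>y. dir_deriv (\<lambda>y. g c y z z') y u) x v"
    by (rule second_derivative_symmetric[OF open_image smooth x])
  then show ?thesis unfolding e curv_def bilinear_simps by linarith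
qed

definition nabla_curv :: "'e \<Rightarrow> 'e \<Rightarrow> 'e \<Rightarrow> 'e \<Rightarrow> 'e \<Rightarrow> 'e"
  where "nabla_curv x w u v z = nabla w (\<lambda>y. curv y u v z) x
    - curv x (\<Gamma> x w u) v z - curv x u (\<Gamma> x w v) z - curv x u v (\<Gamma> x w z)"

definition nabla_ricci :: "'e \<Rightarrow> 'e \<Rightarrow> 'e \<Rightarrow> 'e \<Rightarrow> real"
  where "nabla_ricci x w u v = dir_deriv (\<lambda>y. ricci g c y u v) x w
    - ricci g c x (\<Gamma> x w u) v - ricci g c x u (\<Gamma> x w v)"

text \<open>
This is the Jacobi identity for the operators \<open>nabla u\<close>, \<open>nabla v\<close>, \<open>nabla w\<close>, applied to the constant
field \<open>z\<close>: each of the three summands is a double commutator \<open>[nabla w, [nabla u, nabla v]]\<close>.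
\<close>

lemma second_bianchi_operator_form:
  assumes x: "x \<in> U"
  shows "(nabla w (\<lambda>y. curv y u v z) x - curv x u v (\<Gamma> x w z))
    + (nabla u (\<lambda>y. curv y v w z) x - curv x v w (\<Gamma> x u z))
    + (nabla v (\<lambda>y. curv y w u z) x - curv x w u (\<Gamma> x v z)) = 0"
proof -
  let ?Z = "\<lambda>_::'e. z"
  have sm: "smooth_on U (nabla u ?Z)" for u by (intro nabla_smooth smooth_on_const)
  have 1: "nabla w (\<lambda>y. curv y u v z) x = nabla w (nabla u (nabla v ?Z)) x - nabla w (nabla v (nabla u ?Z)) x" for w u v
    unfolding curv_def by (rule nabla_diff[OF nabla_smooth[OF sm] nabla_smooth[OF sm] x])
  have 2: "curv x u v (\<Gamma> x w z) = nabla u (nabla v (nabla w ?Z)) x - nabla v (nabla u (nabla w ?Z)) x" for w u v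
    using curvature_tensorial[OF sm x, of u v w] by (simp add: nabla_const)
  show ?thesis unfolding 1 2 by simp
qed

text \<open>
The covariant derivative of the curvature contains also the terms \<open>curv x (\<Gamma> x w u) v z\<close> and
\<open>curv x u (\<Gamma> x w v) z\<close>; in the cyclic sum these cancel in pairs, because the connection is torsion-free
and the curvature is antisymmetric in its first two arguments.
\<close>

lemma second_bianchi:
  assumes x: "x \<in> U"
  shows "nabla_curv x w u v z + nabla_curv x u v w z + nabla_curv x v w u z = 0"
  using second_bianchi_operator_form[OF x, of w u v z]
    christoffel_sym[OF x, of u w] christoffel_sym[OF x, of v w] christoffel_sym[OF x, of u v]
    curv_antisym[of x u "\<Gamma> x v w" z] curv_antisym[of x v "\<Gamma> x u w" z] curv_antisym[of x w "\<Gamma> x u v" z]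
  unfolding nabla_curv_def by (simp add: algebra_simps)

lemma nabla_curv_antisym:
  assumes x: "x \<in> U" shows "nabla_curv x w u v z = - nabla_curv x w v u z"
proof -
  have "nabla w (\<lambda>y. curv y u v z) x = - nabla w (\<lambda>y. curv y v u z) x"
    using nabla_diff[OF smooth_on_const curv_smooth x, of w 0 v u z] curv_antisym[of _ u v z]
    by (simp add: nabla_const christoffel_linear[OF x])
  then show ?thesis
    unfolding nabla_curv_def
    using curv_antisym[of x "\<Gamma> x w u" v z] curv_antisym[of x u "\<Gamma> x w v" z] curv_antisym[of x u v "\<Gamma> x w z"]
    by simp
qed

lemma nabla_curv_linear1:
  assumes x: "x \<in> U" shows "linear (\<lambda>w. nabla_curv x w u v z)"
  unfolding nabla_curv_def
  using linear_compose[OF christoffel_linear_left[OF x] curv_linear1[OF x]]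
    linear_compose[OF christoffel_linear_left[OF x] curv_linear2[OF x]]
    linear_compose[OF christoffel_linear_left[OF x] curv_linear3[OF x]]
  by (intro linear_compose_sub nabla_linear curv_smooth x) (simp_all add: o_def)

lemma nabla_curv_linear2:
  assumes x: "x \<in> U" shows "linear (\<lambda>u. nabla_curv x w u v z)"
proof -
  have "linear (\<lambda>u. nabla w (\<lambda>y. curv y u v z) x)"
    unfolding nabla_eq
    using linear_compose[OF curv_linear1[OF x] christoffel_linear_right[OF x]]
      linear_dir_deriv_parameter[OF open_image curv_linear1 smooth_on_differentiable[OF curv_smooth x] x]
    by (intro linear_compose_add) (simp_all add: o_def)
  then show ?thesis
    unfolding nabla_curv_def
    using linear_compose[OF christoffel_linear_right[OF x] curv_linear1[OF x]] curv_linear1[OF x]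
    by (intro linear_compose_sub) (simp_all add: o_def)
qed

text \<open>
Obtained by differentiating \<open>curv_skew\<close>, with the metric property of the connection.
\<close>

lemma nabla_curv_skew:
  assumes x: "x \<in> U"
  shows "g c x (nabla_curv x w u v z) z' = - g c x z (nabla_curv x w u v z')"
proof -
  interpret inner_form "g c x" by (rule form[OF x])
  note sc = smooth_on_const[of U]
  have "dir_deriv (\<lambda>y. g c y (curv y u v z) z') x w = dir_deriv (\<lambda>y. 0 - g c y z (curv y u v z')) x w"
    by (rule fun_cong[OF dir_deriv_cong[OF open_image x]])
      (auto simp: curv_skew intro!: smooth_on_differentiable[of U] metric_smooth_apply curv_smooth sc x)
  also have "\<dots> = - dir_deriv (\<lambda>y. g c y z (curv y u v z')) x w"
    by (subst dir_deriv_diff[OF sc metric_smooth_apply[OF sc curv_smooth] x]) simp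
  finally have "g c x (nabla w (\<lambda>y. curv y u v z) x) z' + g c x (curv x u v z) (\<Gamma> x w z') =
      - (g c x (\<Gamma> x w z) (curv x u v z') + g c x z (nabla w (\<lambda>y. curv y u v z') x))"
    by (simp add: nabla_metric[OF curv_smooth sc x] nabla_metric[OF sc curv_smooth x] nabla_const)
  then show ?thesis
    unfolding nabla_curv_def
    using curv_skew[OF x, of "\<Gamma> x w u" v z z'] curv_skew[OF x, of u "\<Gamma> x w v" z z']
      curv_skew[OF x, of u v "\<Gamma> x w z" z'] curv_skew[OF x, of u v z "\<Gamma> x w z'"]
    by (simp add: bilinear_simps)
qed

end

text \<open>
The trace is a fixed linear functional, so it commutes with derivatives.
\<close>

lemma dir_deriv_endo_trace:
  fixes L :: "'d::real_normed_vector \<Rightarrow> 'e::euclidean_space \<Rightarrow> 'e"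
  assumes "\<And>u. smooth_on S (\<lambda>y. L y u)" "x \<in> S"
  shows "dir_deriv (\<lambda>y. endo_trace (L y)) x v = endo_trace (\<lambda>u. dir_deriv (\<lambda>y. L y u) x v)"
  unfolding endo_trace_def
  by (intro dir_deriv_eq has_derivative_sum has_derivative_inner_left smooth_on_has_derivative[where S=S] assms)

lemma smooth_on_endo_trace:
  fixes L :: "'d::real_normed_vector \<Rightarrow> 'e::euclidean_space \<Rightarrow> 'e"
  assumes "open S" "\<And>u. smooth_on S (\<lambda>y. L y u)"
  shows "smooth_on S (\<lambda>y. endo_trace (L y))"
  unfolding endo_trace_def by (intro smooth_on_sum smooth_on_inner assms)

context metric_chart
begin

lemma trace_commutator:
  assumes x: "x \<in> U" and L: "linear L"
  shows "endo_trace (\<lambda>w. \<Gamma> x u (L w)) = endo_trace (\<lambda>w. L (\<Gamma> x u w))"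
  by (rule endo_trace_commute[OF christoffel_linear_right[OF x] L])

text \<open>
Contraction commutes with covariant differentiation, because the Christoffel terms acting on the
contracted slots form a commutator, which has trace zero.
\<close>

lemma trace_nabla_curv:
  assumes x: "x \<in> U"
  shows "endo_trace (\<lambda>w. nabla_curv x u w v z) = nabla_ricci x u v z"
proof -
  have "dir_deriv (\<lambda>y. ricci g c y v z) x u = dir_deriv (\<lambda>y. endo_trace (\<lambda>w. curv y w v z)) x u"
    by (rule fun_cong[OF dir_deriv_cong[OF open_image x, symmetric]])
      (auto simp: ricci_eq intro!: smooth_on_differentiable[OF smooth_on_endo_trace[OF open_image curv_smooth] x])
  also have "\<dots> = endo_trace (\<lambda>w. dir_deriv (\<lambda>y. curv y w v z) x u)"
    by (rule dir_deriv_endo_trace[OF curv_smooth x])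
  finally show ?thesis
    unfolding nabla_curv_def nabla_ricci_def nabla_eq
    by (simp add: endo_trace_add endo_trace_diff ricci_eq[OF x] trace_commutator[OF x curv_linear1[OF x]])
qed

lemma trace_second_bianchi:
  assumes x: "x \<in> U"
  shows "endo_trace (\<lambda>w. nabla_curv x w u v z) = nabla_ricci x u v z - nabla_ricci x v u z"
proof -
  have "nabla_curv x w u v z = nabla_curv x u w v z - nabla_curv x v w u z" for w
    using second_bianchi[OF x, of w u v z] nabla_curv_antisym[OF x, of u v w z]
    by (simp add: algebra_simps add_eq_0_iff)
  then show ?thesis by (simp add: endo_trace_diff trace_nabla_curv[OF x])
qed

text \<open>
In classical notation, \<open>2 div S = d (tr S)\<close>. Sum \<open>trace_second_bianchi\<close> over \<open>u = z = e\<close>. The left-hand side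
is then a double contraction of \<open>nabla_curv x w u v z\<close>, of \<open>w\<close> with the value and of \<open>u\<close> with \<open>z\<close>. By skewness
in \<open>z\<close> and the value it is minus the contraction of \<open>u\<close> with the value, which gives the covariant
derivative of the Ricci tensor, and of \<open>w\<close> with \<open>z\<close>, which gives its divergence.
\<close>

lemma contracted_bianchi:
  assumes x: "x \<in> U" and E: "inner_form.frame (g c x) E"
  shows "2 * (\<Sum>e\<in>E. nabla_ricci x e v e) = (\<Sum>e\<in>E. nabla_ricci x v e e)"
proof -
  interpret inner_form "g c x" by (rule form[OF x])
  have "(\<Sum>e\<in>E. nabla_ricci x e v e - nabla_ricci x v e e) =
      (\<Sum>e\<in>E. \<Sum>f\<in>E. g c x (nabla_curv x f e v e) f)"
    by (simp add: trace_second_bianchi[OF x, symmetric] endo_trace_frame[OF nabla_curv_linear1[OF x] E])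
  also have "\<dots> = (\<Sum>e\<in>E. \<Sum>f\<in>E. - g c x (nabla_curv x f e v f) e)"
    by (intro sum.cong refl) (metis nabla_curv_skew[OF x] sym)
  also have "\<dots> = (\<Sum>f\<in>E. - (\<Sum>e\<in>E. g c x (nabla_curv x f e v f) e))"
    by (subst sum.swap) (simp add: sum_negf)
  also have "\<dots> = - (\<Sum>f\<in>E. nabla_ricci x f v f)"
    by (simp add: trace_nabla_curv[OF x, symmetric] endo_trace_frame[OF nabla_curv_linear2[OF x] E] sum_negf)
  finally show ?thesis by (simp add: sum_subtractf)
qed

end

section \<open>Almost Kenmotsu structures in a chart\<close>

locale kenmotsu_chart = metric_chart g c
  for g :: "('a, 'e::euclidean_space) tensor2" and c :: "('a, 'e) chart" +
  fixes \<phi> :: "'e \<Rightarrow> 'e \<Rightarrow> 'e" and \<xi> :: "'e \<Rightarrow> 'e" and \<eta> :: "'e \<Rightarrow> 'e \<Rightarrow> real"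
  assumes xi_smooth: "smooth_on U \<xi>"
    and phi_smooth: "smooth_on U (\<lambda>x. \<phi> x u)" and phi_linear: "x \<in> U \<Longrightarrow> linear (\<phi> x)"
    and eta_smooth: "smooth_on U (\<lambda>x. \<eta> x u)" and eta_linear: "x \<in> U \<Longrightarrow> linear (\<eta> x)"
    and phi_square: "x \<in> U \<Longrightarrow> \<phi> x (\<phi> x u) = - u + \<eta> x u *\<^sub>R \<xi> x"
    and eta_xi: "x \<in> U \<Longrightarrow> \<eta> x (\<xi> x) = 1"
    and compatible: "x \<in> U \<Longrightarrow> g c x (\<phi> x u) (\<phi> x v) = g c x u v - \<eta> x u * \<eta> x v"
    and eta_closed: "x \<in> U \<Longrightarrow> dir_deriv (\<lambda>y. \<eta> y v) x u = dir_deriv (\<lambda>y. \<eta> y u) x v"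
    and fundamental_derivative: "x \<in> U \<Longrightarrow>
      dir_deriv (\<lambda>y. g c y v (\<phi> y z)) x u - dir_deriv (\<lambda>y. g c y u (\<phi> y z)) x v
        + dir_deriv (\<lambda>y. g c y u (\<phi> y v)) x z
      = 2 * (\<eta> x u * g c x v (\<phi> x z) - \<eta> x v * g c x u (\<phi> x z) + \<eta> x z * g c x u (\<phi> x v))"
begin

text \<open>
Evaluating \<open>\<phi>\<^sup>3 \<xi>\<close> in two ways shows that \<open>\<phi> \<xi>\<close> is a multiple \<open>r \<xi>\<close>; applying \<open>\<phi>\<close> once more, \<open>r \<phi> \<xi> = 0\<close>,
and either factor being zero gives \<open>\<phi> \<xi> = 0\<close>.
\<close>

lemma phi_xi: assumes x: "x \<in> U" shows "\<phi> x (\<xi> x) = 0"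
proof -
  have 1: "\<phi> x (\<phi> x (\<xi> x)) = 0" using phi_square[OF x] eta_xi[OF x] by simp
  then have "\<phi> x (\<phi> x (\<phi> x (\<xi> x))) = 0" using linear_0[OF phi_linear[OF x]] by simp
  then have 2: "\<phi> x (\<xi> x) = \<eta> x (\<phi> x (\<xi> x)) *\<^sub>R \<xi> x"
    using phi_square[OF x, of "\<phi> x (\<xi> x)"] by (simp add: algebra_simps)
  then have "\<phi> x (\<phi> x (\<xi> x)) = \<eta> x (\<phi> x (\<xi> x)) *\<^sub>R \<phi> x (\<xi> x)"
    by (metis linear_scale[OF phi_linear[OF x]])
  with 1 2 show ?thesis by (metis scaleR_eq_0_iff scaleR_zero_left)
qed

lemma eta_phi: assumes x: "x \<in> U" shows "\<eta> x (\<phi> x u) = 0"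
proof -
  have "\<phi> x (\<phi> x (\<phi> x u)) = - \<phi> x u"
    using linear_diff[OF phi_linear[OF x]] linear_scale[OF phi_linear[OF x]] phi_xi[OF x] by (simp add: phi_square[OF x, of u])
  then have "\<eta> x (\<phi> x u) *\<^sub>R \<xi> x = 0" using phi_square[OF x, of "\<phi> x u"] by simp
  moreover have "\<xi> x \<noteq> 0" using eta_xi[OF x] linear_0[OF eta_linear[OF x]] by auto
  ultimately show ?thesis by simp
qed

lemma metric_xi: assumes x: "x \<in> U" shows "g c x u (\<xi> x) = \<eta> x u" "g c x (\<xi> x) u = \<eta> x u"
proof -
  interpret inner_form "g c x" by (rule form[OF x])
  show "g c x u (\<xi> x) = \<eta> x u"
    using compatible[OF x, of u "\<xi> x"] by (simp add: phi_xi[OF x] eta_xi[OF x] bilinear_simps)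
  then show "g c x (\<xi> x) u = \<eta> x u" by (simp add: sym)
qed

lemma phi_skew: assumes x: "x \<in> U" shows "g c x (\<phi> x u) v = - g c x u (\<phi> x v)"
proof -
  interpret inner_form "g c x" by (rule form[OF x])
  show ?thesis using compatible[OF x, of u "\<phi> x v"]
    by (simp add: phi_square[OF x] bilinear_simps eta_phi[OF x] metric_xi[OF x])
qed

text \<open>
Up to sign, this is the shape operator of the leaves of the kernel of \<open>\<eta>\<close>, whose unit normal is \<open>\<xi>\<close>.
\<close>

definition shape :: "'e \<Rightarrow> 'e \<Rightarrow> 'e"
  where "shape x u = nabla u \<xi> x"

lemma nabla_xi: "nabla u \<xi> = (\<lambda>y. shape y u)"
  by (simp add: fun_eq_iff shape_def)

lemma shape_smooth: "smooth_on U (\<lambda>y. shape y u)"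
  unfolding nabla_xi[symmetric] by (rule nabla_smooth[OF xi_smooth])

lemma shape_linear: "x \<in> U \<Longrightarrow> linear (shape x)"
  using nabla_linear[OF xi_smooth] by (simp add: shape_def[abs_def])

lemma shape_eq: "x \<in> U \<Longrightarrow> shape x u = dir_deriv \<xi> x u + \<Gamma> x (\<xi> x) u"
  by (simp add: shape_def nabla_eq christoffel_sym[of x u])

text \<open>
As the connection is torsion-free and \<open>\<eta> = g(\<cdot>, \<xi>)\<close>, the exterior derivative of \<open>\<eta>\<close> at \<open>(u, v)\<close> is
\<open>g(shape u, v) - g(u, shape v)\<close>.
\<close>

lemma shape_self_adjoint: assumes x: "x \<in> U" shows "g c x (shape x u) v = g c x u (shape x v)"
proof -
  interpret inner_form "g c x" by (rule form[OF x])
  have "dir_deriv (\<lambda>y. \<eta> y v) x u = g c x (\<Gamma> x u v) (\<xi> x) + g c x v (shape x u)" for u v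
  proof -
    have "dir_deriv (\<lambda>y. \<eta> y v) x u = dir_deriv (\<lambda>y. g c y v (\<xi> y)) x u"
      by (rule fun_cong[OF dir_deriv_cong[OF open_image x]])
        (auto simp: metric_xi intro: smooth_on_differentiable[OF eta_smooth x])
    then show ?thesis
      by (simp add: nabla_metric[OF smooth_on_const xi_smooth x] nabla_const shape_def)
  qed
  with eta_closed[OF x, of v u] show ?thesis
    using christoffel_sym[OF x, of u v] sym[of v "shape x u"] by simp
qed

lemma eta_shape: assumes x: "x \<in> U" shows "\<eta> x (shape x u) = 0"
proof -
  have "dir_deriv (\<lambda>y. g c y (\<xi> y) (\<xi> y)) x u = dir_deriv (\<lambda>y. 1) x u"
    by (rule fun_cong[OF dir_deriv_cong[OF open_image x]])
      (auto simp: metric_xi eta_xi intro: smooth_on_differentiable[OF metric_smooth_apply[OF xi_smooth xi_smooth] x])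
  then show ?thesis
    by (simp add: nabla_metric[OF xi_smooth xi_smooth x] metric_xi[OF x] flip: shape_def)
qed

lemma shape_xi: assumes x: "x \<in> U" shows "shape x (\<xi> x) = 0"
proof -
  interpret inner_form "g c x" by (rule form[OF x])
  show ?thesis
    by (rule eqI) (simp add: shape_self_adjoint[OF x] metric_xi[OF x] eta_shape[OF x] bilinear_simps)
qed

lemma lie_derivative_metric:
  assumes x: "x \<in> U" and V: "V c = \<xi>"
  shows "lie_deriv2 V g c x u v = 2 * g c x (shape x u) v"
proof -
  interpret inner_form "g c x" by (rule form[OF x])
  have "lie_deriv2 V g c x u v = dmetric x (\<xi> x) u v + g c x (dir_deriv \<xi> x u) v + g c x u (dir_deriv \<xi> x v)"
    by (simp add: lie_deriv2_def lie_bracket_def V dmetric_def bilinear_simps)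
  also have "\<dots> = g c x (shape x u) v + g c x u (shape x v)"
    by (simp add: christoffel_metric[OF x] shape_eq[OF x] bilinear_simps)
  finally show ?thesis by (simp add: shape_self_adjoint[OF x])
qed

text \<open>
The coordinate derivative of \<open>\<phi>\<close> along \<open>\<xi>\<close>. It is not tensorial by itself; it occurs in the Lie
derivative \<open>dphi z + \<phi> (D\<xi> z) - D\<xi> (\<phi> z)\<close> of \<open>\<phi>\<close> along \<open>\<xi>\<close>, where \<open>D\<xi>\<close> is the coordinate derivative of \<open>\<xi>\<close>.
\<close>

definition dphi :: "'e \<Rightarrow> 'e \<Rightarrow> 'e"
  where "dphi x u = dir_deriv (\<lambda>y. \<phi> y u) x (\<xi> x)"

lemma dphi_linear: "x \<in> U \<Longrightarrow> linear (dphi x)"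
  unfolding dphi_def[abs_def]
  by (rule linear_dir_deriv_parameter[OF open_image phi_linear smooth_on_differentiable[OF phi_smooth]])

text \<open>
As \<open>\<Phi>(\<xi>, \<cdot>) = 0\<close>, contracting \<open>d\<Phi> = 2 \<eta> \<and> \<Phi>\<close> with \<open>\<xi>\<close> says that the Lie derivative of \<open>\<Phi>\<close> along \<open>\<xi>\<close> is
\<open>2 \<Phi>\<close>. Since \<open>\<Phi> = g(\<cdot>, \<phi> \<cdot>)\<close>, that Lie derivative is the sum of the contributions of \<open>g\<close>, which is
\<open>2 g(shape \<cdot>, \<phi> \<cdot>)\<close>, and of \<open>\<phi>\<close>, which is the bracketed term.
\<close>

lemma lie_derivative_phi:
  assumes x: "x \<in> U"
  shows "2 *\<^sub>R shape x (\<phi> x z) + (dphi x z + \<phi> x (dir_deriv \<xi> x z) - dir_deriv \<xi> x (\<phi> x z)) = 2 *\<^sub>R \<phi> x z"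
proof -
  interpret inner_form "g c x" by (rule form[OF x])
  let ?X = "\<xi> x" and ?A = "dir_deriv \<xi> x"
  \<comment> \<open>freezing \<xi> at x in the vanishing function g(\<xi>, \<phi> z) leaves only the derivative of \<xi>\<close>
  have dxi: "dir_deriv (\<lambda>y. g c y ?X (\<phi> y z)) x v = - g c x (?A v) (\<phi> x z)" for v z
  proof -
    have "dir_deriv (\<lambda>y. g c y (\<xi> y) (\<phi> y z)) x v = dir_deriv (\<lambda>y. 0) x v"
      by (rule fun_cong[OF dir_deriv_cong[OF open_image x]])
        (auto simp: metric_xi eta_phi
          intro: smooth_on_differentiable[OF metric_smooth_apply[OF xi_smooth phi_smooth] x])
    then have "g c x (shape x v) (\<phi> x z) + g c x ?X (nabla v (\<lambda>y. \<phi> y z) x) = 0"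
      by (simp add: nabla_metric[OF xi_smooth phi_smooth x] shape_def)
    then show ?thesis
      by (simp add: nabla_metric[OF smooth_on_const phi_smooth x] nabla_const shape_def nabla_eq[of v \<xi>] bilinear_simps)
  qed
  have "shape x (\<phi> x z) + dphi x z + \<Gamma> x ?X (\<phi> x z) + \<phi> x (?A z) = 2 *\<^sub>R \<phi> x z"
  proof (rule eqI)
    fix v
    have "dir_deriv (\<lambda>y. g c y v (\<phi> y z)) x ?X + g c x (?A v) (\<phi> x z) - g c x (?A z) (\<phi> x v)
        = 2 * g c x v (\<phi> x z)"
      using fundamental_derivative[OF x, of v z ?X]
      by (simp add: dxi eta_xi[OF x] metric_xi[OF x] eta_phi[OF x])
    moreover have "dir_deriv (\<lambda>y. g c y v (\<phi> y z)) x ?X =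
        g c x (\<Gamma> x ?X v) (\<phi> x z) + g c x v (dphi x z + \<Gamma> x ?X (\<phi> x z))"
      by (simp add: nabla_metric[OF smooth_on_const phi_smooth x] nabla_const nabla_eq dphi_def)
    moreover have "g c x (\<Gamma> x ?X v) (\<phi> x z) + g c x (?A v) (\<phi> x z) = g c x v (shape x (\<phi> x z))"
      using shape_self_adjoint[OF x, of v "\<phi> x z"] by (simp add: shape_eq[OF x, of v] bilinear_simps)
    moreover have "g c x (?A z) (\<phi> x v) = - g c x v (\<phi> x (?A z))"
      using phi_skew[OF x, of "?A z" v] sym[of v] by simp
    ultimately have "g c x v (shape x (\<phi> x z) + dphi x z + \<Gamma> x ?X (\<phi> x z) + \<phi> x (?A z)) = g c x v (2 *\<^sub>R \<phi> x z)"
      by (simp add: bilinear_simps)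
    then show "g c x (shape x (\<phi> x z) + dphi x z + \<Gamma> x ?X (\<phi> x z) + \<phi> x (?A z)) v = g c x (2 *\<^sub>R \<phi> x z) v"
      by (simp only: sym[of _ v])
  qed
  moreover have "\<Gamma> x ?X (\<phi> x z) = shape x (\<phi> x z) - ?A (\<phi> x z)" by (simp add: shape_eq[OF x])
  ultimately show ?thesis by (simp add: scaleR_2 algebra_simps)
qed

text \<open>
Differentiate \<open>\<phi>\<^sup>2 = - I + \<eta> \<otimes> \<xi>\<close> along \<open>\<xi>\<close> and take the trace: on the left this is \<open>2 tr (\<phi> dphi)\<close>, on the
right the derivative of \<open>\<eta>(\<xi>) = 1\<close>.
\<close>

lemma trace_phi_dphi:
  assumes x: "x \<in> U" shows "endo_trace (\<lambda>u. \<phi> x (dphi x u)) = 0"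
proof -
  let ?X = "\<xi> x"
  have e: "dphi x (\<phi> x u) + \<phi> x (dphi x u) =
      \<eta> x u *\<^sub>R dir_deriv \<xi> x ?X + dir_deriv (\<lambda>y. \<eta> y u) x ?X *\<^sub>R ?X" for u
  proof -
    have "dphi x (\<phi> x u) + \<phi> x (dphi x u) = dir_deriv (\<lambda>y. \<phi> y (\<phi> y u)) x ?X"
      unfolding dphi_def
      by (rule dir_deriv_apply[OF open_image phi_linear smooth_on_differentiable[OF phi_smooth x]
            smooth_on_differentiable[OF phi_smooth x] x, symmetric])
    also have "\<dots> = dir_deriv (\<lambda>y. - u + \<eta> y u *\<^sub>R \<xi> y) x ?X"
      by (rule fun_cong[OF dir_deriv_cong[OF open_image x]])
        (auto simp: phi_square intro: smooth_on_differentiable[OF smooth_on_apply[OF open_image phi_linear phi_smooth phi_smooth] x])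
    also have "\<dots> = dir_deriv (\<lambda>y. \<eta> y u *\<^sub>R \<xi> y) x ?X"
      by (subst dir_deriv_add[OF smooth_on_const smooth_on_scaleR[OF open_image eta_smooth xi_smooth] x]) simp
    also have "\<dots> = \<eta> x u *\<^sub>R dir_deriv \<xi> x ?X + dir_deriv (\<lambda>y. \<eta> y u) x ?X *\<^sub>R ?X"
      by (rule dir_deriv_scaleR[OF eta_smooth xi_smooth x])
    finally show ?thesis .
  qed
  have lin: "linear (\<lambda>u. dir_deriv (\<lambda>y. \<eta> y u) x ?X)"
    by (rule linear_dir_deriv_parameter[OF open_image eta_linear smooth_on_differentiable[OF eta_smooth x] x])
  have "dir_deriv (\<lambda>y. \<eta> y ?X) x ?X + \<eta> x (dir_deriv \<xi> x ?X) = dir_deriv (\<lambda>y. \<eta> y (\<xi> y)) x ?X"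
    by (rule dir_deriv_apply[OF open_image eta_linear smooth_on_differentiable[OF eta_smooth x]
            smooth_on_differentiable[OF xi_smooth x] x, symmetric])
  also have "\<dots> = dir_deriv (\<lambda>y. 1) x ?X"
    by (rule fun_cong[OF dir_deriv_cong[OF open_image x]])
      (auto simp: eta_xi intro: smooth_on_differentiable[OF smooth_on_apply[OF open_image eta_linear eta_smooth xi_smooth] x])
  finally have 0: "\<eta> x (dir_deriv \<xi> x ?X) + dir_deriv (\<lambda>y. \<eta> y ?X) x ?X = 0" by simp
  have "endo_trace (\<lambda>u. dphi x (\<phi> x u)) + endo_trace (\<lambda>u. \<phi> x (dphi x u)) =
      \<eta> x (dir_deriv \<xi> x ?X) + dir_deriv (\<lambda>y. \<eta> y ?X) x ?X"
    by (simp add: e endo_trace_add[symmetric]) (simp add: endo_trace_add endo_trace_rank_one lin eta_linear[OF x])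
  then show ?thesis
    using 0 endo_trace_commute[OF dphi_linear[OF x] phi_linear[OF x]] by simp
qed

text \<open>
Apply \<open>\<phi>\<close> to \<open>lie_derivative_phi\<close> and take traces. The two terms with the derivative of \<open>\<xi>\<close> cancel under
the trace, and \<open>tr (\<phi> shape \<phi>) = tr (\<phi>\<^sup>2 shape) = - tr shape\<close> because \<open>\<eta>\<close> vanishes on the image of
\<open>shape\<close>; on the right, \<open>tr \<phi>\<^sup>2 = 1 - dim\<close>.
\<close>

lemma trace_shape:
  assumes x: "x \<in> U" shows "endo_trace (shape x) = real DIM('e) - 1"
proof -
  let ?A = "dir_deriv \<xi> x"
  have lA: "linear ?A" by (rule dir_deriv_linear[OF xi_smooth x])
  note lp = phi_linear[OF x]
  note lB = shape_linear[OF x]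
  have e: "2 *\<^sub>R \<phi> x (shape x (\<phi> x z)) + \<phi> x (dphi x z) + \<phi> x (\<phi> x (?A z)) - \<phi> x (?A (\<phi> x z))
      = 2 *\<^sub>R \<phi> x (\<phi> x z)" for z
    using arg_cong[OF lie_derivative_phi[OF x, of z], of "\<phi> x"]
    by (simp add: linear_add[OF lp] linear_diff[OF lp] linear_scale[OF lp] algebra_simps)
  have t: "2 * endo_trace (\<lambda>z. \<phi> x (shape x (\<phi> x z))) + endo_trace (\<lambda>z. \<phi> x (dphi x z))
      + endo_trace (\<lambda>z. \<phi> x (\<phi> x (?A z))) - endo_trace (\<lambda>z. \<phi> x (?A (\<phi> x z)))
      = 2 * endo_trace (\<lambda>z. \<phi> x (\<phi> x z))"
    unfolding endo_trace_scale[symmetric] endo_trace_add[symmetric] endo_trace_diff[symmetric]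
    by (simp only: e)
  have A: "endo_trace (\<lambda>z. \<phi> x (?A (\<phi> x z))) = endo_trace (\<lambda>z. \<phi> x (\<phi> x (?A z)))"
    using endo_trace_commute[OF linear_compose[OF lA lp] lp] by (simp add: o_def)
  have "endo_trace (\<lambda>z. \<phi> x (shape x (\<phi> x z))) = endo_trace (\<lambda>z. \<phi> x (\<phi> x (shape x z)))"
    using endo_trace_commute[OF linear_compose[OF lB lp] lp] by (simp add: o_def)
  also have "\<dots> = - endo_trace (shape x)"
    by (simp add: phi_square[OF x] eta_shape[OF x] endo_trace_minus)
  finally have Bt: "endo_trace (\<lambda>z. \<phi> x (shape x (\<phi> x z))) = - endo_trace (shape x)" .
  have "endo_trace (\<lambda>z. \<phi> x (\<phi> x z)) = 1 - real DIM('e)"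
    by (simp add: phi_square[OF x] endo_trace_add endo_trace_diff endo_trace_minus endo_trace_ident
        endo_trace_rank_one[OF eta_linear[OF x]] eta_xi[OF x])
  then show ?thesis using t A Bt trace_phi_dphi[OF x] by simp
qed

section \<open>Ricci curvature in the direction of the Reeb field\<close>

definition nabla_shape :: "'e \<Rightarrow> 'e \<Rightarrow> 'e \<Rightarrow> 'e"
  where "nabla_shape x u v = nabla u (\<lambda>y. shape y v) x - shape x (\<Gamma> x u v)"

lemma nabla_shape_linear1: "x \<in> U \<Longrightarrow> linear (\<lambda>u. nabla_shape x u v)"
  unfolding nabla_shape_def
  using linear_compose[OF christoffel_linear_left shape_linear]
  by (intro linear_compose_sub nabla_linear shape_smooth) (simp_all add: o_def)

lemma nabla_shape_linear2: assumes x: "x \<in> U" shows "linear (nabla_shape x u)"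
proof -
  have "linear (\<lambda>v. nabla u (\<lambda>y. shape y v) x)"
    unfolding nabla_eq
    using linear_compose[OF shape_linear[OF x] christoffel_linear_right[OF x]]
      linear_dir_deriv_parameter[OF open_image shape_linear smooth_on_differentiable[OF shape_smooth x] x]
    by (intro linear_compose_add) (simp_all add: o_def)
  then show ?thesis
    unfolding nabla_shape_def[abs_def]
    using linear_compose[OF christoffel_linear_right[OF x] shape_linear[OF x]]
    by (intro linear_compose_sub) (simp_all add: o_def)
qed

text \<open>
The commutator of covariant derivatives is applied to \<open>\<xi>\<close>, with \<open>nabla v \<xi> = shape v\<close>.
\<close>

lemma curv_xi:
  assumes x: "x \<in> U" shows "curv x u v (\<xi> x) = nabla_shape x u v - nabla_shape x v u"
  using curvature_tensorial[OF xi_smooth x, of u v] christoffel_sym[OF x, of u v]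
  by (simp add: nabla_xi nabla_shape_def)

lemma trace_nabla_shape:
  assumes x: "x \<in> U" shows "endo_trace (nabla_shape x u) = 0"
proof -
  have "dir_deriv (\<lambda>y. endo_trace (shape y)) x u = dir_deriv (\<lambda>y. real DIM('e) - 1) x u"
    by (rule fun_cong[OF dir_deriv_cong[OF open_image x]])
      (auto simp: trace_shape intro: smooth_on_differentiable[OF smooth_on_endo_trace[OF open_image shape_smooth] x])
  then have "endo_trace (\<lambda>v. dir_deriv (\<lambda>y. shape y v) x u) = 0"
    by (simp add: dir_deriv_endo_trace[OF shape_smooth x])
  then show ?thesis
    by (simp add: nabla_shape_def[abs_def] nabla_eq endo_trace_add endo_trace_diff trace_commutator[OF x shape_linear[OF x]])
qed

lemma ricci_xi:
  assumes x: "x \<in> U" shows "ricci g c x v (\<xi> x) = endo_trace (\<lambda>u. nabla_shape x u v)"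
  using trace_nabla_shape[OF x, of v]
  by (simp add: ricci_eq[OF x] curv_xi[OF x] endo_trace_diff)

text \<open>
Differentiating \<open>shape \<xi> = 0\<close> along \<open>u\<close> gives \<open>nabla_shape u \<xi> = - shape (shape u)\<close>.
\<close>

lemma ricci_xi_xi:
  assumes x: "x \<in> U" shows "ricci g c x (\<xi> x) (\<xi> x) = - endo_trace (\<lambda>u. shape x (shape x u))"
proof -
  have "nabla_shape x u (\<xi> x) = - shape x (shape x u)" for u
  proof -
    have "dir_deriv (\<lambda>y. shape y (\<xi> y)) x u = dir_deriv (\<lambda>y. 0) x u"
      by (rule fun_cong[OF dir_deriv_cong[OF open_image x]])
        (auto simp: shape_xi intro: smooth_on_differentiable[OF smooth_on_apply[OF open_image shape_linear shape_smooth xi_smooth] x])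
    moreover have "dir_deriv (\<lambda>y. shape y (\<xi> y)) x u = dir_deriv (\<lambda>y. shape y (\<xi> x)) x u + shape x (dir_deriv \<xi> x u)"
      by (rule dir_deriv_apply[OF open_image shape_linear smooth_on_differentiable[OF shape_smooth x]
            smooth_on_differentiable[OF xi_smooth x] x])
    ultimately have "dir_deriv (\<lambda>y. shape y (\<xi> x)) x u = - shape x (dir_deriv \<xi> x u)"
      by (simp add: eq_neg_iff_add_eq_0)
    then show ?thesis
      by (simp add: nabla_shape_def nabla_eq shape_xi[OF x] christoffel_linear[OF x] shape_def[of x u] linear_add[OF shape_linear[OF x]])
  qed
  then show ?thesis by (simp add: ricci_xi[OF x] endo_trace_minus)
qed

text \<open>
Under the soliton equation the covariant derivative of the Ricci tensor is minus that of
\<open>g(shape \<cdot>, \<cdot>)\<close>. So the contracted Bianchi identity says that twice the divergence of \<open>shape\<close> is the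
differential of its trace, which is zero by \<open>trace_shape\<close>; and the divergence of \<open>shape\<close> is
\<open>S(\<cdot>, \<xi>)\<close>.
\<close>

lemma soliton_ricci_xi:
  assumes sol: "\<And>x u v. x \<in> U \<Longrightarrow> ricci g c x u v = l * g c x u v - g c x (shape x u) v"
    and x: "x \<in> U"
  shows "ricci g c x v (\<xi> x) = 0"
proof -
  interpret inner_form "g c x" by (rule form[OF x])
  have nr: "nabla_ricci x w u v = - g c x (nabla_shape x w u) v" for w u v
  proof -
    have "dir_deriv (\<lambda>y. ricci g c y u v) x w = dir_deriv (\<lambda>y. l *\<^sub>R g c y u v - g c y (shape y u) v) x w"
    proof (rule fun_cong[OF dir_deriv_cong[OF open_image x, symmetric]])
      show "(\<lambda>y. l *\<^sub>R g c y u v - g c y (shape y u) v) differentiable (at x)"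
        by (intro smooth_on_differentiable[where S=U] smooth_on_diff smooth_on_scaleR
          smooth_on_const smooth metric_smooth_apply shape_smooth open_image x)
    qed (simp add: sol)
    also have "\<dots> = l * dmetric x w u v - (g c x (nabla w (\<lambda>y. shape y u) x) v + g c x (shape x u) (\<Gamma> x w v))"
      by (subst dir_deriv_diff[OF smooth_on_scaleR[OF open_image smooth_on_const smooth]
            metric_smooth_apply[OF shape_smooth smooth_on_const] x],
          subst dir_deriv_scaleR[OF smooth_on_const smooth x])
        (simp add: nabla_metric[OF shape_smooth smooth_on_const x] nabla_const dmetric_def)
    finally show ?thesis
      by (simp add: nabla_ricci_def sol[OF x] christoffel_metric[OF x] nabla_shape_def bilinear_simps algebra_simps)
  qed
  obtain E where E: "frame E" using frame_exists by blast
  have "2 * endo_trace (\<lambda>u. nabla_shape x u v) = endo_trace (nabla_shape x v)"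
    using contracted_bianchi[OF x E, of v]
    by (simp add: nr sum_negf endo_trace_frame[OF nabla_shape_linear1[OF x] E] endo_trace_frame[OF nabla_shape_linear2[OF x] E])
  then show ?thesis by (simp add: trace_nabla_shape[OF x] ricci_xi[OF x])
qed

lemma no_soliton:
  assumes sol: "\<And>x u v. x \<in> U \<Longrightarrow> ricci g c x u v = l * g c x u v - g c x (shape x u) v"
    and x: "x \<in> U" and dim: "DIM('e) > 1"
  shows False
proof -
  interpret inner_form "g c x" by (rule form[OF x])
  have "endo_trace (shape x) \<noteq> 0" using trace_shape[OF x] dim by simp
  then have "shape x \<noteq> (\<lambda>u. 0)" by (auto simp: endo_trace_def)
  from endo_trace_square_pos[OF shape_linear[OF x] shape_self_adjoint[OF x] this]
  show False using soliton_ricci_xi[OF sol x, of "\<xi> x"] ricci_xi_xi[OF x] by simp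
qed

end

section \<open>Nonexistence of the soliton\<close>

lemma kenmotsu_chartI:
  assumes K: "almost_kenmotsu X A \<phi> \<xi> \<eta> g" and c: "c \<in> A"
  shows "kenmotsu_chart g c (\<phi> c) (\<xi> c) (\<eta> c)"
proof -
  have vf: "vector_field A \<xi>" and ef: "endo_field A \<phi>" and wf: "one_form A \<eta>"
    and rm: "riemannian_metric A g" and tf: "tensor2_field A g" and sa: "smooth_atlas X A"
    using K by (simp_all add: almost_kenmotsu_def almost_contact_metric_def almost_contact_def
        riemannian_metric_def smooth_manifold_def)
  have acm: "almost_contact_metric A \<phi> \<xi> \<eta> g" using K by (simp add: almost_kenmotsu_def)
  have d2: "ext_deriv2 (fundamental_form \<phi> g) c x u v z = 2 * wedge12 \<eta> (fundamental_form \<phi> g) c x u v z"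
    if "x \<in> chart_image c" for x u v z using K c that unfolding almost_kenmotsu_def by blast
  have d1: "ext_deriv1 \<eta> c x u v = 0"
    if "x \<in> chart_image c" for x u v using K c that unfolding almost_kenmotsu_def by blast
  show ?thesis
  proof (intro kenmotsu_chart.intro metric_chart.intro inner_form.intro kenmotsu_chart_axioms.intro)
    show "open (chart_image c)" using sa c by (simp add: smooth_atlas_def is_chart_def)
    fix x u v z
    show "smooth_on (chart_image c) (\<lambda>x. g c x u v)" using tf c by (simp add: tensor2_field_def)
    show "smooth_on (chart_image c) (\<xi> c)" using vf c by (simp add: vector_field_def)
    show "smooth_on (chart_image c) (\<lambda>x. \<phi> c x u)" using ef c by (simp add: endo_field_def)
    show "smooth_on (chart_image c) (\<lambda>x. \<eta> c x u)" using wf c by (simp add: one_form_def)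
    assume x: "x \<in> chart_image c"
    show "bilinear (g c x)" using tf c x by (simp add: tensor2_field_def)
    show "g c x u v = g c x v u" using rm c x unfolding riemannian_metric_def by blast
    show "0 < g c x u u" if "u \<noteq> 0" using rm c x that unfolding riemannian_metric_def by blast
    show "linear (\<phi> c x)" using ef c x by (simp add: endo_field_def)
    show "linear (\<eta> c x)" using wf c x by (simp add: one_form_def)
    show "\<phi> c x (\<phi> c x u) = - u + \<eta> c x u *\<^sub>R \<xi> c x" "\<eta> c x (\<xi> c x) = 1"
      "g c x (\<phi> c x u) (\<phi> c x v) = g c x u v - \<eta> c x u * \<eta> c x v"
      using acm c x by (simp_all add: almost_contact_metric_def almost_contact_def)
    show "dir_deriv (\<lambda>y. \<eta> c y v) x u = dir_deriv (\<lambda>y. \<eta> c y u) x v"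
      using d1[OF x, of u v] by (simp add: ext_deriv1_def)
    show "dir_deriv (\<lambda>y. g c y v (\<phi> c y z)) x u - dir_deriv (\<lambda>y. g c y u (\<phi> c y z)) x v
        + dir_deriv (\<lambda>y. g c y u (\<phi> c y v)) x z
      = 2 * (\<eta> c x u * g c x v (\<phi> c x z) - \<eta> c x v * g c x u (\<phi> c x z) + \<eta> c x z * g c x u (\<phi> c x v))"
      using d2[OF x, of u v z] by (simp add: ext_deriv2_def wedge12_def fundamental_form_def)
  qed
qed

theorem theorem3p1:
  fixes n :: nat
    and X :: "'a topology"
    and A :: "('a, 'e::euclidean_space) chart set"
    and \<phi> :: "('a, 'e) endo" and \<xi> :: "('a, 'e) vfield"
    and \<eta> :: "('a, 'e) form1" and g :: "('a, 'e) tensor2"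
  assumes "n \<ge> 1" and "DIM('e) = 2 * n + 1"
    and "almost_kenmotsu X A \<phi> \<xi> \<eta> g"
  shows "\<not> (\<exists>l::real. ricci_soliton X A g \<xi> l)"
proof
  assume "\<exists>l. ricci_soliton X A g \<xi> l"
  then obtain l where sol: "ricci_soliton X A g \<xi> l" ..
  have "topspace X \<noteq> {}" "(\<Union>c\<in>A. fst c) = topspace X"
    using assms(3) unfolding almost_kenmotsu_def smooth_manifold_def smooth_atlas_def by blast+
  then obtain c where c: "c \<in> A" "fst c \<noteq> {}" by blast
  then obtain x where x: "x \<in> chart_image c" unfolding chart_image_def by blast
  interpret kenmotsu_chart g c "\<phi> c" "\<xi> c" "\<eta> c" by (rule kenmotsu_chartI[OF assms(3) c(1)])
  have "ricci g c y u v = l * g c y u v - g c y (shape y u) v" if y: "y \<in> chart_image c" for y u v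
  proof -
    have "lie_deriv2 \<xi> g c y u v + 2 * ricci g c y u v - 2 * l * g c y u v = 0"
      using sol c(1) y unfolding ricci_soliton_def by blast
    then show ?thesis by (simp add: lie_derivative_metric[of y \<xi>, OF y refl])
  qed
  from no_soliton[OF this x] show False using assms(1,2) by simp
qed

end
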